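(* Let $n\ge0$ and $m\ge1$ be integers. For any fixed choice of square roots $\sqrt{x_i}$ of nonzero $x_1,\dots,x_m$, $$P_n(x_1,\dots,x_m)=q^{\frac14 m(m-1-2n)}\left(\frac{1-q^{n+1}}{1-q}\right)^m\prod_{i=1}^m(\sqrt{x_i})^n\prod_{1\le i<j\le m}\frac{\sqrt{x_i}+\sqrt{x_j}}{1+\sqrt{x_ix_j}}$$ $$\times\sum_{k_1,\dots,k_m=0}^n\ \prod_{1\le i<j\le m}\frac{q^{k_j}-q^{k_i}}{1-q^{k_i+k_j+1}}\prod_{i=1}^m\frac{(q^{-n},q^{n+2},\sqrt{q/x_i},-\sqrt{qx_i};q)_{k_i}}{(q,q,q^{3/2},-q^{3/2};q)_{k_i}}\,q^{k_i},$$ as an identity of rational functions in $\sqrt{x_1},\dots,\sqrt{x_m}$.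
   Context: $q$ is a generic complex parameter: $q\neq 0$ and $q$ is not a root of unity; a square root $q^{1/2}$ is fixed and used throughout, so that $q^{3/2}=(q^{1/2})^3$, $q^{\frac14 m(m-1-2n)}=(q^{1/2})^{\frac12m(m-1)-mn}$, $\sqrt{q/x_i}=q^{1/2}/\sqrt{x_i}$, $\sqrt{qx_i}=q^{1/2}\sqrt{x_i}$, and $\sqrt{x_ix_j}=\sqrt{x_i}\sqrt{x_j}$. $(a;q)_k=(1-a)(1-aq)\cdots(1-aq^{k-1})$ and $(a_1,\dots,a_r;q)_k=(a_1;q)_k\cdots(a_r;q)_k$. For integers $n\ge 0$, $m\ge1$, $$P_n(x_1,\dots,x_m)=\frac{(-q;q)_n^m}{(q;q)_n^m}\sum_{k_1,\dots,k_m=0}^n\ \prod_{1\le i<j\le m}\frac{q^{k_j}-q^{k_i}}{q^{k_j}+q^{k_i}}\prod_{i=1}^m\frac{(-q,q^{-n};q)_{k_i}}{(q,-q^{-n};q)_{k_i}}\,x_i^{k_i}.$$ *)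

theory Defs
  imports Complex_Main "HOL-Library.FuncSet"
begin

definition qpoch :: "complex \<Rightarrow> complex \<Rightarrow> nat \<Rightarrow> complex" where
  "qpoch a q k = (\<Prod>l<k. 1 - a * q ^ l)"

text \<open>The multi-parameter symbol \<open>(a\<^sub>1, \<dots>, a\<^sub>r; q)\<^sub>k\<close>.\<close>

definition qpochs :: "complex list \<Rightarrow> complex \<Rightarrow> nat \<Rightarrow> complex" where
  "qpochs as q k = prod_list (map (\<lambda>a. qpoch a q k) as)"

definition index_pairs :: "nat \<Rightarrow> (nat \<times> nat) set" where
  "index_pairs m = {(i, j). 1 \<le> i \<and> i < j \<and> j \<le> m}"

text \<open>
  Tuples \<open>(k\<^sub>1, \<dots>, k\<^sub>m)\<close> with entries in \<open>{0..n}\<close> are extensional functions on \<open>{1..m}\<close>,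
  so that each tuple is counted exactly once in a sum over this set.
\<close>

definition index_tuples :: "nat \<Rightarrow> nat \<Rightarrow> (nat \<Rightarrow> nat) set" where
  "index_tuples n m = {1..m} \<rightarrow>\<^sub>E {0..n}"

text \<open>
  The variables \<open>x\<^sub>1, \<dots>, x\<^sub>m\<close> are the values of \<open>x\<close> on \<open>{1..m}\<close>.  If \<open>q\<close> is nonzero and
  not a root of unity then no denominator below vanishes.
\<close>

definition P :: "complex \<Rightarrow> nat \<Rightarrow> nat \<Rightarrow> (nat \<Rightarrow> complex) \<Rightarrow> complex" where
  "P q n m x =
     qpoch (- q) q n ^ m / qpoch q q n ^ m *
     (\<Sum>k\<in>index_tuples n m.
        (\<Prod>(i, j)\<in>index_pairs m. (q ^ k j - q ^ k i) / (q ^ k j + q ^ k i)) *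
        (\<Prod>i=1..m. qpochs [- q, q powi (- int n)] q (k i) /
                     qpochs [q, - (q powi (- int n))] q (k i) * x i ^ k i))"

end

theory Submission
  imports Defs "HOL-Library.Multiset" "HOL-Computational_Algebra.Polynomial"
begin

text \<open>
  Both sides are sums over tuples \<open>(k\<^sub>1, \<dots>, k\<^sub>m)\<close> of a product of one-index weights and of a
  product over pairs of a kernel \<open>K(k\<^sub>i, k\<^sub>j)\<close>.  All kernels that occur are of the form
  \<open>tanh(t\<^sub>j - t\<^sub>i)\<close> up to a change of variable, and the addition formula of the hyperbolic
  tangent gives the three-term relation \<open>K a b * K a c * K b c = K a b - K a c + K b c\<close>.  This
  relation alone implies that the product of \<open>K\<close> over all pairs expands along its first argument
  like a Pfaffian (Schur's Pfaffian in the classical case; \<open>schur_kernel_expansions\<close>).  Hence such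
  a multiple sum is a Pfaffian-like expression in its sums with \<open>m = 1\<close> and \<open>m = 2\<close>, and two multiple
  sums, possibly with different kernels and index sets, agree as soon as their single and double sums
  agree (\<open>tuple_sum_transfer\<close>).

  The factor \<open>\<Prod> (s\<^sub>i + s\<^sub>j) / (1 + s\<^sub>i s\<^sub>j)\<close> in the theorem prevents a direct comparison of the two
  sides: it depends on the pair but not on the summation indices.  An intermediate sum over signs
  \<open>e\<^sub>i = \<plusminus>1\<close> absorbs it.  With \<open>v\<^sub>i = s\<^sub>i - 1 / s\<^sub>i\<close>, the two kernels
  \<open>(e\<^sub>i s\<^sub>i - e\<^sub>j s\<^sub>j) / (1 - e\<^sub>i s\<^sub>i e\<^sub>j s\<^sub>j)\<close> and \<open>(e\<^sub>i v\<^sub>j - e\<^sub>j v\<^sub>i) / (v\<^sub>i + v\<^sub>j)\<close> on signs both satisfy the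
  three-term relation, and their quotient is exactly \<open>(s\<^sub>i + s\<^sub>j) / (1 + s\<^sub>i s\<^sub>j)\<close>, whatever the signs are.
  With the weights \<open>(\<Gamma>\<^sub>i + e\<^sub>i \<Lambda>\<^sub>i) / 2\<close>, where \<open>\<Gamma>\<^sub>i\<close> is \<open>P\<^sub>n(x\<^sub>i)\<close> and \<open>\<Lambda>\<^sub>i\<close> is
  \<open>- s\<^sub>i P\<^sub>n\<^sub>-\<^sub>1(x\<^sub>i)\<close> (0 for \<open>n = 0\<close>), the sum over signs with the first kernel equals \<open>P\<^sub>n\<close>, and the one with the second kernel
  equals the multiple basic hypergeometric sum (\<open>P_eq_aw_multisum_generic\<close>).

  What is left are the cases of one and two variables.  In one variable the statement is the known
  passage between two forms of the continuous \<open>q\<close>-ultraspherical polynomials with \<open>\<beta> = -q\<close>: both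
  forms satisfy the same three-term recurrence in \<open>n\<close> (\<open>rogers_eq_aw_sum\<close>).  In two variables each
  double sum, times the denominator that belongs to it, is an antisymmetric combination of the polynomials
  of degrees \<open>n\<close> and \<open>n - 1\<close>, as in a Christoffel-Darboux formula; both such formulas hold
  coefficient by coefficient (\<open>rogers_pair_sum_formula\<close> and \<open>aw_pair_sum_formula\<close>).

  The argument divides by \<open>s\<^sub>i + s\<^sub>j\<close> and by \<open>s\<^sub>i s\<^sub>j - 1\<close>.  Moving \<open>s\<^sub>i\<close> to \<open>s\<^sub>i + i t\<close> makes these
  nonzero for all small \<open>t \<noteq> 0\<close>, and both sides are continuous at \<open>t = 0\<close>.
\<close>

section \<open>The Pfaffian expansion of a kernel product\<close>

fun kernel_prod :: "('a \<Rightarrow> 'a \<Rightarrow> 'c::comm_ring_1) \<Rightarrow> 'a list \<Rightarrow> 'c" where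
  "kernel_prod K [] = 1"
| "kernel_prod K (a # as) = (\<Prod>b\<leftarrow>as. K a b) * kernel_prod K as"

text \<open>
  The sum of \<open>(-1)\<^sup>j \<phi> b\<^sub>j bs\<^sub>j\<close>, where \<open>bs\<^sub>j\<close> is \<open>bs\<close> without its entry \<open>b\<^sub>j\<close>, counted from
  \<open>j = 0\<close>: the shape of a row expansion of a Pfaffian.
\<close>

fun alt_removal :: "('a \<Rightarrow> 'a list \<Rightarrow> 'c::comm_ring_1) \<Rightarrow> 'a list \<Rightarrow> 'c" where
  "alt_removal \<phi> [] = 0"
| "alt_removal \<phi> (b # bs) = \<phi> b bs - alt_removal (\<lambda>c cs. \<phi> c (b # cs)) bs"

text \<open>
  Equivalently \<open>K a c * (1 + K a b * K b c) = K a b + K b c\<close>, the addition formula of the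
  hyperbolic tangent for \<open>K a b = tanh (t\<^sub>b - t\<^sub>a)\<close>.
\<close>

definition schur_kernel_on :: "'a set \<Rightarrow> ('a \<Rightarrow> 'a \<Rightarrow> 'c::comm_ring_1) \<Rightarrow> bool" where
  "schur_kernel_on A K \<longleftrightarrow>
     (\<forall>a\<in>A. \<forall>b\<in>A. \<forall>c\<in>A. K a b * K a c * K b c = K a b - K a c + K b c)"

lemma schur_kernel_on_subset: "schur_kernel_on B K \<Longrightarrow> A \<subseteq> B \<Longrightarrow> schur_kernel_on A K"
  unfolding schur_kernel_on_def by (meson subsetD)

lemma alt_removal_cong:
  assumes "\<And>c r. mset (c # r) = mset bs \<Longrightarrow> \<phi> c r = \<psi> c r"
  shows "alt_removal \<phi> bs = alt_removal \<psi> bs"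
  using assms
proof (induction bs arbitrary: \<phi> \<psi>)
  case (Cons b bs)
  have "alt_removal (\<lambda>c cs. \<phi> c (b # cs)) bs = alt_removal (\<lambda>c cs. \<psi> c (b # cs)) bs"
    by (rule Cons.IH) (rule Cons.prems, simp)
  with Cons.prems[of b bs] show ?case by simp
qed simp

lemma alt_removal_add:
  "alt_removal (\<lambda>c r. \<phi> c r + \<psi> c r) bs = alt_removal \<phi> bs + alt_removal \<psi> bs"
  by (induction bs arbitrary: \<phi> \<psi>) (simp_all add: algebra_simps)

lemma alt_removal_diff:
  "alt_removal (\<lambda>c r. \<phi> c r - \<psi> c r) bs = alt_removal \<phi> bs - alt_removal \<psi> bs"
  by (induction bs arbitrary: \<phi> \<psi>) (simp_all add: algebra_simps)

lemma alt_removal_mult: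
  "alt_removal (\<lambda>c r. x * \<phi> c r) bs = x * alt_removal \<phi> bs"
  by (induction bs arbitrary: \<phi>) (simp_all add: algebra_simps)

lemma alt_removal_sum:
  "(\<Sum>k\<in>J. x k * alt_removal (\<psi> k) bs) = alt_removal (\<lambda>c r. \<Sum>k\<in>J. x k * \<psi> k c r) bs"
  by (induction bs arbitrary: \<psi>) (simp_all add: right_diff_distrib sum_subtractf)

text \<open>
  Removing first \<open>b\<close> and then \<open>c\<close> leaves the same list as removing them in the other order, but with
  the opposite sign.
\<close>

lemma alt_removal_twice:
  "alt_removal (\<lambda>b. alt_removal (\<lambda>c. \<phi> b c)) bs = - alt_removal (\<lambda>b. alt_removal (\<lambda>c. \<phi> c b)) bs"
proof (induction bs arbitrary: \<phi>)
  case (Cons x bs)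
  show ?case
    using Cons.IH[of "\<lambda>b c cs. \<phi> b c (x # cs)"]
    by (simp add: alt_removal_diff)
qed simp

lemma prod_list_mset_eq:
  assumes "mset (c # r) = mset bs"
  shows "(\<Prod>b\<leftarrow>bs. (f b::'c::comm_ring_1)) = f c * (\<Prod>b\<leftarrow>r. f b)"
proof -
  have *: "(\<Prod>b\<leftarrow>l. f b) = prod_mset (image_mset f (mset l))" for l
    by (induction l) simp_all
  show ?thesis by (simp add: * flip: assms)
qed

lemma removal_length_set:
  assumes "mset (c # r) = mset bs"
  shows "length bs = Suc (length r)" "set bs = insert c (set r)"
  using mset_eq_length[OF assms] mset_eq_setD[OF assms] by auto

text \<open>
  The second formula is the row expansion of a Pfaffian, for lists of either parity; a list of odd
  length behaves as if a last entry with kernel value 1 were appended.  The two formulas are proved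
  together by induction on the length.  For the second one, split off the second entry \<open>b\<close> as well,
  expand the kernel product of \<open>a\<close> and the remaining entries, and turn each product
  \<open>K a b * K a c * K b c\<close> into a sum by the three-term relation; the terms with \<open>K a b\<close> and \<open>K b c\<close>
  are then evaluated by the first formula.  For the first one, insert the second formula into every
  summand: the double removals are antisymmetric, so that they collapse to a single expansion.
\<close>

theorem schur_kernel_expansions:
  fixes K :: "'a \<Rightarrow> 'a \<Rightarrow> 'c::comm_ring_1"
  assumes K: "schur_kernel_on A K" and "set bs \<subseteq> A"
  shows "alt_removal (\<lambda>c. kernel_prod K) bs = of_bool (odd (length bs)) * kernel_prod K bs"
    and "a \<in> A \<Longrightarrow> kernel_prod K (a # bs) =
           of_bool (even (length bs)) * kernel_prod K bs +
           alt_removal (\<lambda>c r. K a c * kernel_prod K r) bs"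
proof -
  let ?E = "kernel_prod K" and ?alt = alt_removal
  define B where "B bs \<longleftrightarrow> ?alt (\<lambda>c. ?E) bs = of_bool (odd (length bs)) * ?E bs" for bs
  define S where "S a bs \<longleftrightarrow> ?E (a # bs) =
    of_bool (even (length bs)) * ?E bs + ?alt (\<lambda>c r. K a c * ?E r) bs" for a bs
  have "(\<forall>a bs. Suc (length bs) = L \<and> insert a (set bs) \<subseteq> A \<longrightarrow> S a bs) \<and>
        (\<forall>bs. length bs = L \<and> set bs \<subseteq> A \<longrightarrow> B bs)" for L
  proof (induction L rule: less_induct)
    case (less L)
    have IHS: "S a bs" if "Suc (length bs) < L" "a \<in> A" "set bs \<subseteq> A" for a bs
      using less that by auto
    have IHB: "B bs" if "length bs < L" "set bs \<subseteq> A" for bs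
      using less that by auto
    have S: "S a bs" if len: "Suc (length bs) = L" and A: "a \<in> A" "set bs \<subseteq> A" for a bs
    proof (cases bs)
      case Nil
      then show ?thesis by (simp add: S_def)
    next
      case (Cons b cs)
      have b: "b \<in> A" "set cs \<subseteq> A" and l: "length cs < L" "Suc (length cs) < L"
        using Cons A len by auto
      let ?P = "\<Prod>c\<leftarrow>cs. K b c"
      let ?e = "of_bool (even (length cs)) :: 'c"
      let ?o = "of_bool (odd (length cs)) :: 'c"
      have "?E (a # b # cs) = K a b * ?P * ?E (a # cs)"
        by (simp add: algebra_simps)
      also have "?E (a # cs) = ?e * ?E cs + ?alt (\<lambda>c r. K a c * ?E r) cs"
        using IHS[OF l(2) A(1) b(2)] by (simp add: S_def)
      also have "K a b * ?P * \<dots> =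
          K a b * (?e * ?E (b # cs)) + ?alt (\<lambda>c r. K a b * ?P * (K a c * ?E r)) cs"
        unfolding alt_removal_mult by (simp add: algebra_simps)
      \<comment> \<open>The factor \<open>K b c\<close> that the three-term relation needs is the one in \<open>?P\<close> that belongs to \<open>c\<close>.\<close>
      also have "?alt (\<lambda>c r. K a b * ?P * (K a c * ?E r)) cs =
          ?alt (\<lambda>c r. (K a b - K a c + K b c) * ?E (b # r)) cs"
      proof (rule alt_removal_cong)
        fix c r assume cr: "mset (c # r) = mset cs"
        have "c \<in> A" using removal_length_set(2)[OF cr] b(2) by auto
        then have three: "K a b * K a c * K b c = K a b - K a c + K b c"
          using K A(1) b(1) by (auto simp: schur_kernel_on_def)
        have P: "?P = K b c * (\<Prod>c\<leftarrow>r. K b c)" by (rule prod_list_mset_eq[OF cr])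
        show "K a b * ?P * (K a c * ?E r) = (K a b - K a c + K b c) * ?E (b # r)"
          by (simp only: kernel_prod.simps P three[symmetric] mult_ac)
      qed
      also have "\<dots> = K a b * ?alt (\<lambda>c r. ?E (b # r)) cs - ?alt (\<lambda>c r. K a c * ?E (b # r)) cs
          + ?alt (\<lambda>c r. K b c * ?E (b # r)) cs"
        by (simp add: alt_removal_add alt_removal_diff ring_distribs alt_removal_mult
              del: kernel_prod.simps)
      also have "?alt (\<lambda>c r. K b c * ?E (b # r)) cs = ?alt (\<lambda>c r. ?P * ?E r) cs"
        by (intro alt_removal_cong) (simp add: prod_list_mset_eq mult.assoc)
      also have "\<dots> = ?o * ?E (b # cs)"
        using IHB[OF l(1) b(2)] unfolding B_def alt_removal_mult by (simp add: mult_ac)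
      also have "?alt (\<lambda>c r. ?E (b # r)) cs = ?E cs - ?e * ?E (b # cs)"
      proof -
        have "B (b # cs)" using b l by (intro IHB) auto
        then have "?E cs - ?alt (\<lambda>c r. ?E (b # r)) cs = ?e * ?E (b # cs)"
          unfolding B_def alt_removal.simps by (simp only: length_Cons even_Suc not_not)
        then show ?thesis by (simp add: algebra_simps)
      qed
      finally have "?E (a # b # cs) = K a b * (?e * ?E (b # cs)) +
        (K a b * (?E cs - ?e * ?E (b # cs)) - ?alt (\<lambda>c r. K a c * ?E (b # r)) cs + ?o * ?E (b # cs))" .
      moreover have "k * (e * F) + (k * (G - e * F) - B + d * F) = d * F + (k * G - B)"
        for k e F G B d :: 'c by (simp add: algebra_simps)
      ultimately show ?thesis
        unfolding S_def Cons alt_removal.simps length_Cons even_Suc by (simp only:)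
    qed
    have "B bs" if len: "length bs = L" and A: "set bs \<subseteq> A" for bs
    proof (cases bs)
      case Nil
      then show ?thesis by (simp add: B_def)
    next
      case (Cons a cs)
      have a: "a \<in> A" "set cs \<subseteq> A" and l: "Suc (length cs) = L" using Cons A len by auto
      let ?e = "of_bool (even (length cs)) :: 'c"
      let ?o = "of_bool (odd (length cs)) :: 'c"
      have "?alt (\<lambda>c r. ?E (a # r)) cs =
          ?alt (\<lambda>c r. ?o * ?E r + ?alt (\<lambda>d r'. K a d * ?E r') r) cs"
      proof (rule alt_removal_cong)
        fix c r assume cr: "mset (c # r) = mset cs"
        note ls = removal_length_set[OF cr]
        have "S a r" using ls l a by (intro IHS) auto
        then show "?E (a # r) = ?o * ?E r + ?alt (\<lambda>d r'. K a d * ?E r') r"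
          by (simp add: S_def ls)
      qed
      also have "\<dots> = ?o * ?alt (\<lambda>c. ?E) cs + ?alt (\<lambda>c. ?alt (\<lambda>d r'. K a d * ?E r')) cs"
        by (simp add: alt_removal_add alt_removal_mult)
      \<comment> \<open>After the swap, the entry \<open>d\<close> that meets \<open>a\<close> is removed first and the inner removal falls under the first formula.\<close>
      also have "?alt (\<lambda>c. ?alt (\<lambda>d r'. K a d * ?E r')) cs =
          - ?alt (\<lambda>d. ?alt (\<lambda>c r'. K a d * ?E r')) cs"
        by (rule alt_removal_twice)
      also have "?alt (\<lambda>d. ?alt (\<lambda>c r'. K a d * ?E r')) cs = ?alt (\<lambda>d r. ?e * (K a d * ?E r)) cs"
      proof (rule alt_removal_cong)
        fix d r assume dr: "mset (d # r) = mset cs"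
        note ls = removal_length_set[OF dr]
        have "B r" using ls l a by (intro IHB) auto
        then show "?alt (\<lambda>c r'. K a d * ?E r') r = ?e * (K a d * ?E r)"
          by (simp add: B_def ls alt_removal_mult)
      qed
      also have "\<dots> = ?e * ?alt (\<lambda>d r. K a d * ?E r) cs"
        by (rule alt_removal_mult)
      also have "?alt (\<lambda>c. ?E) cs = ?o * ?E cs"
        using IHB[of cs] a l by (simp add: B_def)
      finally have "?alt (\<lambda>c. ?E) (a # cs) =
          ?e * (?e * ?E cs + ?alt (\<lambda>d r. K a d * ?E r) cs)"
        by (auto simp: of_bool_def)
      also have "\<dots> = ?e * ?E (a # cs)"
        using S[OF l a] by (simp add: S_def)
      finally show ?thesis unfolding Cons B_def by simp
    qed
    with S show ?case by auto
  qed
  then show "?alt (\<lambda>c. ?E) bs = of_bool (odd (length bs)) * ?E bs"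
    and "a \<in> A \<Longrightarrow> ?E (a # bs) =
           of_bool (even (length bs)) * ?E bs + ?alt (\<lambda>c r. K a c * ?E r) bs"
    using assms(2) unfolding B_def S_def by auto
qed

section \<open>Multiple sums with a kernel product\<close>

text \<open>
  The index tuple is handed to \<open>\<phi>\<close> as a list of pairs, position and value, because the kernels
  on signs depend on the position.
\<close>

fun tuple_sum :: "'a set \<Rightarrow> ('i \<Rightarrow> 'a \<Rightarrow> 'c::comm_ring_1) \<Rightarrow> (('i \<times> 'a) list \<Rightarrow> 'c) \<Rightarrow> 'i list \<Rightarrow> 'c" where
  "tuple_sum I w \<phi> [] = \<phi> []"
| "tuple_sum I w \<phi> (i # is) = (\<Sum>k\<in>I. w i k * tuple_sum I w (\<lambda>ps. \<phi> ((i, k) # ps)) is)"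

lemma tuple_sum_cong:
  assumes "\<And>ps. map fst ps = is \<Longrightarrow> snd ` set ps \<subseteq> I \<Longrightarrow> \<phi> ps = \<psi> ps"
  shows "tuple_sum I w \<phi> is = tuple_sum I w \<psi> is"
  using assms
proof (induction "is" arbitrary: \<phi> \<psi>)
  case (Cons i "is")
  have "tuple_sum I w (\<lambda>ps. \<phi> ((i, k) # ps)) is = tuple_sum I w (\<lambda>ps. \<psi> ((i, k) # ps)) is"
    if "k \<in> I" for k
    by (rule Cons.IH, rule Cons.prems) (use that in auto)
  then show ?case by simp
qed simp

lemma tuple_sum_add:
  "tuple_sum I w (\<lambda>ps. \<phi> ps + \<psi> ps) is = tuple_sum I w \<phi> is + tuple_sum I w \<psi> is"
  by (induction "is" arbitrary: \<phi> \<psi>) (simp_all add: algebra_simps sum.distrib)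

lemma tuple_sum_diff:
  "tuple_sum I w (\<lambda>ps. \<phi> ps - \<psi> ps) is = tuple_sum I w \<phi> is - tuple_sum I w \<psi> is"
  by (induction "is" arbitrary: \<phi> \<psi>) (simp_all add: right_diff_distrib sum_subtractf)

lemma tuple_sum_mult:
  "tuple_sum I w (\<lambda>ps. x * \<phi> ps) is = x * tuple_sum I w \<phi> is"
  by (induction "is" arbitrary: \<phi>) (simp_all add: algebra_simps sum_distrib_left)

text \<open>
  Removing an entry of the tuple of summation indices means summing that index separately over its
  own weight, while the other indices form a shorter tuple.
\<close>

lemma tuple_sum_alt_removal:
  "tuple_sum I w (alt_removal \<phi>) is =
   alt_removal (\<lambda>j js. \<Sum>l\<in>I. w j l * tuple_sum I w (\<phi> (j, l)) js) is"
proof (induction "is" arbitrary: \<phi>)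
  case (Cons i "is")
  have "tuple_sum I w (alt_removal \<phi>) (i # is) =
     (\<Sum>k\<in>I. w i k * tuple_sum I w (\<phi> (i, k)) is) -
     (\<Sum>k\<in>I. w i k * tuple_sum I w (alt_removal (\<lambda>c cs. \<phi> c ((i, k) # cs))) is)"
    by (simp add: tuple_sum_diff algebra_simps sum_subtractf)
  also have "(\<Sum>k\<in>I. w i k * tuple_sum I w (alt_removal (\<lambda>c cs. \<phi> c ((i, k) # cs))) is) =
     (\<Sum>k\<in>I. w i k * alt_removal (\<lambda>j js. \<Sum>l\<in>I. w j l * tuple_sum I w (\<lambda>cs. \<phi> (j, l) ((i, k) # cs)) js) is)"
    by (simp add: Cons.IH)
  also have "\<dots> = alt_removal (\<lambda>j js. \<Sum>k\<in>I. w i k * (\<Sum>l\<in>I. w j l * tuple_sum I w (\<lambda>cs. \<phi> (j, l) ((i, k) # cs)) js)) is"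
    by (rule alt_removal_sum)
  also have "\<dots> = alt_removal (\<lambda>j js. \<Sum>l\<in>I. w j l * tuple_sum I w (\<phi> (j, l)) (i # js)) is"
    by (rule alt_removal_cong) (simp add: sum_distrib_left mult.left_commute, rule sum.swap)
  finally show ?case by simp
qed simp

text \<open>
  The Pfaffian expansion, summed over all tuples: the first position enters only through its single
  sum and its double sums with the other positions.
\<close>

lemma tuple_sum_recursion:
  fixes K :: "'i \<times> 'a \<Rightarrow> 'i \<times> 'a \<Rightarrow> 'c::comm_ring_1"
  assumes K: "schur_kernel_on (insert i (set is) \<times> I) K"
  shows "tuple_sum I w (kernel_prod K) (i # is) =
     of_bool (even (length is)) * (\<Sum>k\<in>I. w i k) * tuple_sum I w (kernel_prod K) is +
     alt_removal (\<lambda>j js. (\<Sum>k\<in>I. \<Sum>l\<in>I. w i k * w j l * K (i, k) (j, l)) *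
                         tuple_sum I w (kernel_prod K) js) is"
proof -
  let ?e = "of_bool (even (length is)) :: 'c"
  have "tuple_sum I w (kernel_prod K) (i # is) =
     (\<Sum>k\<in>I. w i k * tuple_sum I w (\<lambda>ps. ?e * kernel_prod K ps +
        alt_removal (\<lambda>p r. K (i, k) p * kernel_prod K r) ps) is)"
    unfolding tuple_sum.simps
  proof (intro sum.cong refl arg_cong2[of _ _ _ _ "(*)"] tuple_sum_cong)
    fix k ps assume k: "k \<in> I" and ps: "map fst ps = is" "snd ` set ps \<subseteq> I"
    have "set ps \<subseteq> insert i (set is) \<times> I"
      using ps by force
    then show "kernel_prod K ((i, k) # ps) = ?e * kernel_prod K ps +
        alt_removal (\<lambda>p r. K (i, k) p * kernel_prod K r) ps"
      using schur_kernel_expansions(2)[OF K, of ps "(i, k)"] k ps(1) by auto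
  qed
  also have "\<dots> = ?e * (\<Sum>k\<in>I. w i k) * tuple_sum I w (kernel_prod K) is +
     (\<Sum>k\<in>I. w i k * tuple_sum I w (alt_removal (\<lambda>p r. K (i, k) p * kernel_prod K r)) is)"
    unfolding tuple_sum_add tuple_sum_mult
    by (simp add: distrib_left sum.distrib sum_distrib_left sum_distrib_right mult.assoc mult.left_commute)
  also have "(\<Sum>k\<in>I. w i k * tuple_sum I w (alt_removal (\<lambda>p r. K (i, k) p * kernel_prod K r)) is) =
     (\<Sum>k\<in>I. w i k * alt_removal (\<lambda>j js. \<Sum>l\<in>I. w j l * (K (i, k) (j, l) * tuple_sum I w (kernel_prod K) js)) is)"
    unfolding tuple_sum_alt_removal tuple_sum_mult ..
  also have "\<dots> = alt_removal (\<lambda>j js. \<Sum>k\<in>I. w i k * (\<Sum>l\<in>I. w j l * (K (i, k) (j, l) * tuple_sum I w (kernel_prod K) js))) is"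
    by (rule alt_removal_sum)
  finally show ?thesis
    by (simp add: sum_distrib_left sum_distrib_right mult.assoc)
qed

text \<open>
  By induction on the number of positions, since the recursion above mentions the kernel and the
  weights only through the single and double sums that are assumed to agree.
\<close>

theorem tuple_sum_transfer:
  fixes K :: "'i \<times> 'a \<Rightarrow> 'i \<times> 'a \<Rightarrow> 'c::comm_ring_1"
    and K' :: "'i \<times> 'b \<Rightarrow> 'i \<times> 'b \<Rightarrow> 'c"
  assumes K: "schur_kernel_on (X \<times> I) K" and K': "schur_kernel_on (X \<times> J) K'"
    and one: "\<And>i. i \<in> X \<Longrightarrow> (\<Sum>k\<in>I. w i k) = (\<Sum>k\<in>J. w' i k)"
    and two: "\<And>i j. i \<in> X \<Longrightarrow> j \<in> X \<Longrightarrow> i \<noteq> j \<Longrightarrow>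
      (\<Sum>k\<in>I. \<Sum>l\<in>I. w i k * w j l * K (i, k) (j, l)) =
      (\<Sum>k\<in>J. \<Sum>l\<in>J. w' i k * w' j l * K' (i, k) (j, l))"
    and "set is \<subseteq> X" "distinct is"
  shows "tuple_sum I w (kernel_prod K) is = tuple_sum J w' (kernel_prod K') is"
  using assms(5,6)
proof (induction "is" rule: length_induct)
  case (1 "is")
  note IH = 1(1)[rule_format]
  show ?case
  proof (cases "is")
    case (Cons i js)
    have X: "i \<in> X" "set js \<subseteq> X" "distinct js" "i \<notin> set js" using Cons 1 by auto
    have sub: "insert i (set js) \<times> S \<subseteq> X \<times> S" for S :: "'x set" using X by auto
    have S: "schur_kernel_on (insert i (set js) \<times> I) K" "schur_kernel_on (insert i (set js) \<times> J) K'"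
      by (rule schur_kernel_on_subset[OF K sub], rule schur_kernel_on_subset[OF K' sub])
    have "alt_removal (\<lambda>j r. (\<Sum>k\<in>I. \<Sum>l\<in>I. w i k * w j l * K (i, k) (j, l)) *
                         tuple_sum I w (kernel_prod K) r) js =
       alt_removal (\<lambda>j r. (\<Sum>k\<in>J. \<Sum>l\<in>J. w' i k * w' j l * K' (i, k) (j, l)) *
                         tuple_sum J w' (kernel_prod K') r) js"
    proof (intro alt_removal_cong arg_cong2[of _ _ _ _ "(*)"] two IH)
      fix c r assume cr: "mset (c # r) = mset js"
      note ls = removal_length_set[OF cr]
      show "i \<in> X" "c \<in> X" "i \<noteq> c" "length r < length is" "set r \<subseteq> X"
        using X ls Cons by auto
      show "distinct r" using cr X(3) by (metis distinct.simps(2) mset_eq_imp_distinct_iff)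
    qed
    moreover have "tuple_sum I w (kernel_prod K) js = tuple_sum J w' (kernel_prod K') js"
      using Cons X by (intro IH) auto
    ultimately show ?thesis
      unfolding Cons tuple_sum_recursion[OF S(1)] tuple_sum_recursion[OF S(2)] one[OF X(1)] by simp
  qed simp
qed

lemma kernel_prod_sorted:
  assumes "sorted_wrt (<) (is :: nat list)"
  shows "kernel_prod K (map p is) =
    (\<Prod>(i, j)\<in>{(i, j). i \<in> set is \<and> j \<in> set is \<and> i < j}. K (p i) (p j))"
  using assms
proof (induction "is")
  case (Cons a "is")
  let ?P = "\<lambda>is. {(i, j). i \<in> set is \<and> j \<in> set is \<and> i < j}"
  have fin: "finite (?P js)" for js :: "nat list"
    by (rule finite_subset[of _ "set js \<times> set js"]) auto
  have d: "distinct is" using Cons.prems by (simp add: strict_sorted_iff)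
  have "?P (a # is) = Pair a ` set is \<union> ?P is" using Cons.prems by fastforce
  then have "(\<Prod>(i, j)\<in>?P (a # is). K (p i) (p j)) =
      (\<Prod>(i, j)\<in>Pair a ` set is. K (p i) (p j)) * (\<Prod>(i, j)\<in>?P is. K (p i) (p j))"
    using Cons.prems fin by (simp only:) (rule prod.union_disjoint, auto)
  also have "(\<Prod>(i, j)\<in>Pair a ` set is. K (p i) (p j)) = (\<Prod>b\<leftarrow>map p is. K (p a) b)"
    by (subst prod.reindex) (auto simp: inj_on_def prod.distinct_set_conv_list[OF d] o_def)
  finally show ?case using Cons by simp
qed simp

lemma tuple_sum_conv_PiE:
  fixes w :: "'i \<Rightarrow> 'a \<Rightarrow> 'c::comm_ring_1"
  assumes "distinct is"
  shows "tuple_sum I w \<phi> is =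
    (\<Sum>k\<in>set is \<rightarrow>\<^sub>E I. (\<Prod>i\<in>set is. w i (k i)) * \<phi> (map (\<lambda>i. (i, k i)) is))"
  using assms
proof (induction "is" arbitrary: \<phi>)
  case (Cons i "is")
  let ?S = "\<lambda>k :: 'i \<Rightarrow> 'a. (\<Prod>i\<in>set (i # is). w i (k i)) * \<phi> (map (\<lambda>i. (i, k i)) (i # is))"
  have i: "i \<notin> set is" using Cons.prems by simp
  have "(\<Sum>k\<in>set (i # is) \<rightarrow>\<^sub>E I. ?S k) = (\<Sum>(y, g)\<in>I \<times> (set is \<rightarrow>\<^sub>E I). ?S (g(i := y)))"
    unfolding list.set PiE_insert_eq
    by (subst sum.reindex[OF inj_combinator[OF i]]) (simp add: case_prod_unfold)
  also have "\<dots> = (\<Sum>y\<in>I. \<Sum>g\<in>set is \<rightarrow>\<^sub>E I. ?S (g(i := y)))"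
    by (simp add: sum.cartesian_product)
  also have "\<dots> = (\<Sum>y\<in>I. \<Sum>g\<in>set is \<rightarrow>\<^sub>E I. w i y * ((\<Prod>i\<in>set is. w i (g i)) * \<phi> ((i, y) # map (\<lambda>i. (i, g i)) is)))"
  proof (intro sum.cong refl)
    fix y and g :: "'i \<Rightarrow> 'a"
    have m: "map (\<lambda>j. (j, (g(i := y)) j)) is = map (\<lambda>i. (i, g i)) is"
      using i by (auto intro!: map_cong)
    have p: "(\<Prod>j\<in>set is. w j ((g(i := y)) j)) = (\<Prod>i\<in>set is. w i (g i))"
      using i by (intro prod.cong) auto
    show "?S (g(i := y)) = w i y * ((\<Prod>i\<in>set is. w i (g i)) * \<phi> ((i, y) # map (\<lambda>i. (i, g i)) is))"
      unfolding list.map list.set prod.insert[OF finite_set i] m p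
      by (simp only: fun_upd_same mult.assoc)
  qed
  also have "\<dots> = tuple_sum I w \<phi> (i # is)"
    using Cons by (simp add: sum_distrib_left)
  finally show ?case by simp
qed simp
lemma tuple_sum_index_tuples:
  "tuple_sum {0..n} w (kernel_prod K) [1..<Suc m] =
    (\<Sum>k\<in>index_tuples n m. (\<Prod>(i, j)\<in>index_pairs m. K (i, k i) (j, k j)) * (\<Prod>i=1..m. w i (k i)))"
proof -
  have set: "set [1..<Suc m] = {1..m}" by auto
  have pairs: "{(i, j). i \<in> {1..m} \<and> j \<in> {1..m} \<and> i < j} = index_pairs m"
    by (auto simp: index_pairs_def)
  have "kernel_prod K (map (\<lambda>i. (i, k i)) [1..<Suc m]) = (\<Prod>(i, j)\<in>index_pairs m. K (i, k i) (j, k j))" for k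
    by (subst kernel_prod_sorted) (simp_all only: set pairs sorted_wrt_upt)
  then show ?thesis
    by (subst tuple_sum_conv_PiE) (simp_all only: set index_tuples_def distinct_upt mult.commute)
qed

lemma finite_index_pairs: "finite (index_pairs m)"
  by (rule finite_subset[of _ "{1..m} \<times> {1..m}"]) (auto simp: index_pairs_def)

lemma card_index_pairs: "card (index_pairs m) = m * (m - 1) div 2"
proof (induction m)
  case 0
  have "index_pairs 0 = {}" by (auto simp: index_pairs_def)
  then show ?case by simp
next
  case (Suc m)
  have "index_pairs (Suc m) = index_pairs m \<union> (\<lambda>i. (i, Suc m)) ` {1..m}"
    by (auto simp: index_pairs_def)
  also have "card \<dots> = card (index_pairs m) + card ((\<lambda>i. (i, Suc m)) ` {1..m})"
    by (rule card_Un_disjoint[OF finite_index_pairs]) (auto simp: index_pairs_def)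
  also have "card ((\<lambda>i. (i, Suc m)) ` {1..m}) = m"
    by (simp add: card_image inj_on_def)
  finally show ?case using Suc by (cases m) simp_all
qed

section \<open>Three kernels\<close>

text \<open>
  With \<open>v = exp (2 t)\<close> this quotient is \<open>tanh (t\<^sub>y - t\<^sub>x)\<close>; it is the kernel of \<open>P\<^sub>n\<close>.
\<close>

lemma schur_kernel_ratio:
  fixes v :: "'a \<Rightarrow> complex"
  assumes "\<And>x y. x \<in> A \<Longrightarrow> y \<in> A \<Longrightarrow> v y + v x \<noteq> 0"
  shows "schur_kernel_on A (\<lambda>x y. (v y - v x) / (v y + v x))"
proof -
  have "(b - a) / (b + a) * ((c - a) / (c + a)) * ((c - b) / (c + b)) =
      (b - a) / (b + a) - (c - a) / (c + a) + (c - b) / (c + b)"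
    if "b + a \<noteq> 0" "c + a \<noteq> 0" "c + b \<noteq> 0" for a b c :: complex
    using that by (simp add: divide_simps) algebra
  then show ?thesis using assms by (simp add: schur_kernel_on_def)
qed

text \<open>
  With \<open>v = tanh t\<close> this quotient is \<open>tanh (t\<^sub>y - t\<^sub>x)\<close>; it is the kernel of the basic hypergeometric
  sum, with \<open>v = q\<^sup>k\<^sup>+\<^sup>1\<^sup>/\<^sup>2\<close>, and, on signs, the kernel with the points \<open>v = - e\<^sub>i s\<^sub>i\<close>.
\<close>

lemma schur_kernel_tanh:
  fixes v :: "'a \<Rightarrow> complex"
  assumes "\<And>x y. x \<in> A \<Longrightarrow> y \<in> A \<Longrightarrow> 1 - v x * v y \<noteq> 0"
  shows "schur_kernel_on A (\<lambda>x y. (v y - v x) / (1 - v x * v y))"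
proof -
  have "(b - a) / (1 - a * b) * ((c - a) / (1 - a * c)) * ((c - b) / (1 - b * c)) =
      (b - a) / (1 - a * b) - (c - a) / (1 - a * c) + (c - b) / (1 - b * c)"
    if "1 - a * b \<noteq> 0" "1 - a * c \<noteq> 0" "1 - b * c \<noteq> 0" for a b c :: complex
    using that by (simp add: divide_simps) algebra
  then show ?thesis using assms by (simp add: schur_kernel_on_def)
qed

text \<open>
  For equal signs this is, up to that sign, the kernel \<open>(v\<^sub>j - v\<^sub>i) / (v\<^sub>j + v\<^sub>i)\<close>, and for different
  signs it is the constant \<open>e\<close>, as if the points \<open>(i, 1)\<close> and \<open>(i, -1)\<close> were \<open>v\<^sub>i\<close> and an infinite
  multiple of \<open>1 / v\<^sub>i\<close>.
\<close>

lemma schur_kernel_signed: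
  fixes v :: "'i \<Rightarrow> complex"
  assumes "\<And>i j. i \<in> X \<Longrightarrow> j \<in> X \<Longrightarrow> v i + v j \<noteq> 0"
  shows "schur_kernel_on (X \<times> {1, -1}) (\<lambda>(i, e) (j, f). (e * v j - f * v i) / (v i + v j))"
proof -
  have "(e * b - f * a) / (a + b) * ((e * c - g * a) / (a + c)) * ((f * c - g * b) / (b + c)) =
      (e * b - f * a) / (a + b) - (e * c - g * a) / (a + c) + (f * c - g * b) / (b + c)"
    if "a + b \<noteq> 0" "a + c \<noteq> 0" "b + c \<noteq> 0" "e \<in> {1, -1}" "f \<in> {1, -1}" "g \<in> {1, -1}"
    for a b c e f g :: complex
  proof -
    have "e * e = 1" "f * f = 1" "g * g = 1" using that by auto
    then have "(e * b - f * a) * (e * c - g * a) * (f * c - g * b) =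
      (e * b - f * a) * ((a + c) * (b + c)) - (e * c - g * a) * ((a + b) * (b + c)) + (f * c - g * b) * ((a + b) * (a + c))"
      by algebra
    moreover have "x / (a + b) - y / (a + c) + z / (b + c) =
        (x * ((a + c) * (b + c)) - y * ((a + b) * (b + c)) + z * ((a + b) * (a + c))) / ((a + b) * (a + c) * (b + c))"
      for x y z using that(1-3) by (simp add: add_divide_distrib diff_divide_distrib)
    ultimately show ?thesis by (simp only: times_divide_times_eq)
  qed
  then show ?thesis using assms unfolding schur_kernel_on_def by fastforce
qed

text \<open>
  The two-by-two determinant on the right is why the sum over signs fits here: the double sums of
  both sides of the theorem have this form, up to a factor.
\<close>

lemma signed_pair_sum:
  fixes a a' g g' v v' d :: complex
  shows "(\<Sum>e\<in>{1, -1}. \<Sum>f\<in>{1, -1}. (g + e * a) / 2 * ((g' + f * a') / 2) * ((e * v' - f * v) / d)) =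
    (a * g' * v' - g * a' * v) / d"
proof -
  have "(\<Sum>e\<in>{1, -1}. \<Sum>f\<in>{1, -1}. (g + e * a) / 2 * ((g' + f * a') / 2) * ((e * v' - f * v) / d)) =
     (((g + a) * (g' + a') - (g - a) * (g' - a')) * (v' - v) + ((g + a) * (g' - a') - (g - a) * (g' + a')) * (v' + v)) / (4 * d)"
    by (simp add: diff_divide_distrib add_divide_distrib algebra_simps)
  also have "((g + a) * (g' + a') - (g - a) * (g' - a')) * (v' - v) + ((g + a) * (g' - a') - (g - a) * (g' + a')) * (v' + v)
      = 4 * (a * g' * v' - g * a' * v)"
    by (simp add: algebra_simps)
  also have "4 * (a * g' * v' - g * a' * v) / (4 * d) = (a * g' * v' - g * a' * v) / d"
    by (rule mult_divide_mult_cancel_left) simp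
  finally show ?thesis .
qed

section \<open>Shifted factorials at a generic parameter\<close>

lemma qpoch_0 [simp]: "qpoch a q 0 = 1"
  by (simp add: qpoch_def)

lemma qpoch_Suc: "qpoch a q (Suc k) = qpoch a q k * (1 - a * q ^ k)"
  by (simp add: qpoch_def)

lemma qpoch_Suc_front: "qpoch a q (Suc k) = (1 - a) * qpoch (a * q) q k"
  unfolding qpoch_def by (subst prod.lessThan_Suc_shift) (simp add: mult.assoc)

lemma qpoch_shift: "(1 - a) * qpoch (a * q) q k = qpoch a q k * (1 - a * q ^ k)"
  using qpoch_Suc_front[of a q k] by (simp add: qpoch_Suc)

text \<open>
  Multiplication by the variable shifts coefficients; the value 0 at the front lets the boundary
  terms of a shifted sum take part in identities between coefficients.
\<close>

fun shifted :: "(nat \<Rightarrow> complex) \<Rightarrow> nat \<Rightarrow> complex" where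
  "shifted g 0 = 0"
| "shifted g (Suc k) = g k"

locale generic_parameter =
  fixes q r :: complex
  assumes q_nonzero: "q \<noteq> 0"
    and q_not_root_of_unity: "k \<ge> 1 \<Longrightarrow> q ^ k \<noteq> 1"
    and sqrt_q: "r\<^sup>2 = q"
begin

lemma r_nonzero: "r \<noteq> 0"
  using q_nonzero sqrt_q by auto

lemma q_power_eq_1_iff: "q ^ k = 1 \<longleftrightarrow> k = 0"
  using q_not_root_of_unity[of k] by (cases "k = 0") auto

lemma one_plus_q_power: "1 + q ^ k \<noteq> 0"
proof
  assume "1 + q ^ k = 0"
  then have *: "q ^ k = -1" by (simp add: eq_neg_iff_add_eq_0 add.commute)
  then have "q ^ (2 * k) = 1" by (simp add: power_mult mult.commute[of 2])
  then have "k = 0" by (simp add: q_power_eq_1_iff)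
  with * show False by simp
qed

lemma q_power_add_nonzero: "q ^ k + q ^ l \<noteq> 0"
proof -
  have "q ^ i + q ^ (i + d) \<noteq> 0" for i d
  proof -
    have "q ^ i + q ^ (i + d) = q ^ i * (1 + q ^ d)" by (simp add: power_add distrib_left)
    then show ?thesis using one_plus_q_power[of d] q_nonzero by simp
  qed
  then show ?thesis
    by (cases "k \<le> l") (metis add.commute le_add_diff_inverse nat_le_linear)+
qed

section \<open>Rogers polynomials and their double sums\<close>

definition qratio :: "nat \<Rightarrow> complex" where
  "qratio k = qpoch (- q) q k / qpoch q q k"

text \<open>
  This is \<open>(-1; q)\<^sub>k / (2 (q; q)\<^sub>k)\<close>.  It is a common factor of \<open>qratio k\<close> and \<open>qratio (k - 1)\<close>
  whose cofactors \<open>1 + q\<^sup>k\<close> and \<open>1 - q\<^sup>k\<close> are also correct at \<open>k = 0\<close>, where the latter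
  vanishes.  So identities between shifted coefficients become polynomial identities without boundary cases.
\<close>

definition \<beta> :: "nat \<Rightarrow> complex" where
  "\<beta> k = qratio k / (1 + q ^ k)"

lemma qratio_eq: "qratio k = (1 + q ^ k) * \<beta> k"
  using one_plus_q_power by (simp add: \<beta>_def)

lemma qratio_Suc: "qratio (Suc k) = qratio k * (1 + q ^ Suc k) / (1 - q ^ Suc k)"
  by (simp add: qratio_def qpoch_Suc)

lemma shifted_qratio_eq: "shifted qratio k = (1 - q ^ k) * \<beta> k"
proof (cases k)
  case (Suc j)
  have "1 - q ^ Suc j \<noteq> 0" "1 + q ^ Suc j \<noteq> 0"
    using q_not_root_of_unity[of "Suc j"] one_plus_q_power[of "Suc j"] by auto
  then show ?thesis
    unfolding Suc shifted.simps \<beta>_def qratio_Suc by (simp del: power_Suc)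
qed simp

definition alt_conv :: "(nat \<Rightarrow> complex) \<Rightarrow> (nat \<Rightarrow> complex) \<Rightarrow> nat \<Rightarrow> nat \<Rightarrow> complex" where
  "alt_conv g h n k = (-1) ^ k * g k * h (n - k)"

text \<open>
  Up to rescaling, the continuous \<open>q\<close>-ultraspherical (Rogers) polynomial of degree \<open>n\<close> with parameter
  \<open>- q\<close>; it is \<open>P\<^sub>n\<close> in one variable.
\<close>

definition rogers :: "nat \<Rightarrow> complex \<Rightarrow> complex" where
  "rogers n x = (\<Sum>k\<le>n. alt_conv qratio qratio n k * x ^ k)"

text \<open>
  Reversing the two factorials with base points \<open>q\<^sup>-\<^sup>n\<close> and \<open>- q\<^sup>-\<^sup>n\<close> makes the symmetry
  between \<open>k\<close> and \<open>n - k\<close> visible.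
\<close>

lemma coefficient_eq:
  assumes "k \<le> n"
  shows "qpoch (- q) q n / qpoch q q n *
    (qpochs [- q, q powi (- int n)] q k / qpochs [q, - (q powi (- int n))] q k) = alt_conv qratio qratio n k"
  using assms
proof (induction k)
  case 0
  then show ?case by (simp add: qpochs_def alt_conv_def qratio_def)
next
  case (Suc k)
  let ?c = "\<lambda>k. qpochs [- q, q powi (- int n)] q k / qpochs [q, - (q powi (- int n))] q k"
  obtain d where n: "n = Suc (k + d)"
    using Suc.prems by (metis add_Suc less_eq_Suc_le less_natE)
  have nz: "q ^ n \<noteq> 0" "1 - q ^ Suc k \<noteq> 0" "1 - q ^ Suc d \<noteq> 0" "1 + q ^ Suc d \<noteq> 0"
    using q_nonzero q_not_root_of_unity[of "Suc _"] one_plus_q_power[of "Suc d"] by auto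
  have *: "q powi (- int n) * q ^ k = 1 / q ^ Suc d"
  proof -
    have "q powi (- int n) = inverse (q ^ n)" by (simp only: power_int_minus power_int_of_nat)
    then show ?thesis using q_nonzero by (simp add: n power_add field_simps)
  qed
  have "?c (Suc k) = ?c k * ((1 + q ^ Suc k) * (1 - q powi (- int n) * q ^ k)
      / ((1 - q ^ Suc k) * (1 + q powi (- int n) * q ^ k)))"
    by (simp add: qpochs_def qpoch_Suc mult_ac)
  note c = this[unfolded *]
  have e: "1 + 1 / q ^ Suc d = (1 + q ^ Suc d) / q ^ Suc d" "1 - 1 / q ^ Suc d = - (1 - q ^ Suc d) / q ^ Suc d"
    using q_nonzero by (simp_all add: field_simps)
  have g: "a * (- e / D) / (c * (g / D)) = - (a / c) * (e / g)" if "D \<noteq> 0" for a c e g D :: complex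
    using that by simp
  have f: "(1 + q ^ Suc k) * (1 - 1 / q ^ Suc d) / ((1 - q ^ Suc k) * (1 + 1 / q ^ Suc d)) =
      - ((1 + q ^ Suc k) / (1 - q ^ Suc k)) * ((1 - q ^ Suc d) / (1 + q ^ Suc d))"
    unfolding e by (rule g) (use q_nonzero in simp)
  have "qpoch (- q) q n / qpoch q q n * ?c (Suc k) = alt_conv qratio qratio n k *
      (- ((1 + q ^ Suc k) / (1 - q ^ Suc k)) * ((1 - q ^ Suc d) / (1 + q ^ Suc d)))"
    unfolding c f using Suc by (simp only: mult.assoc[symmetric] Suc_leD)
  also have "\<dots> = alt_conv qratio qratio n (Suc k)"
    using nz(2-4) by (simp add: alt_conv_def n qratio_Suc Suc_diff_le del: power_Suc) (simp add: field_simps)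
  finally show ?case .
qed

lemma rogers_Suc: "rogers (Suc n) x = (\<Sum>k\<le>Suc n. alt_conv qratio qratio (Suc n) k * x ^ k)"
  by (simp add: rogers_def)

lemma sum_alt_conv_shift_left:
  "(\<Sum>k\<le>n. alt_conv g h n k * x ^ k * \<psi> (Suc k)) * x = - (\<Sum>k\<le>Suc n. alt_conv (shifted g) h (Suc n) k * x ^ k * \<psi> k)"
  by (subst sum.atMost_Suc_shift) (simp add: alt_conv_def sum_distrib_right sum_distrib_left sum_negf[symmetric] mult_ac)

lemma sum_alt_conv_shift_right:
  "(\<Sum>k\<le>n. alt_conv g h n k * x ^ k * \<psi> k) = (\<Sum>k\<le>Suc n. alt_conv g (shifted h) (Suc n) k * x ^ k * \<psi> k)"
  by (simp add: alt_conv_def Suc_diff_le)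

lemma rogers_shifts:
  "rogers n x = (\<Sum>k\<le>Suc n. alt_conv qratio (shifted qratio) (Suc n) k * x ^ k)"
  "x * rogers n x = - (\<Sum>k\<le>Suc n. alt_conv (shifted qratio) qratio (Suc n) k * x ^ k)"
  using sum_alt_conv_shift_right[of qratio qratio n x "\<lambda>_. 1"] sum_alt_conv_shift_left[of qratio qratio n x "\<lambda>_. 1"]
  by (simp_all add: rogers_def mult.commute)

lemma one_minus_mult_rogers:
  "(1 - x) * rogers n x = (\<Sum>k\<le>Suc n. (alt_conv qratio (shifted qratio) (Suc n) k + alt_conv (shifted qratio) qratio (Suc n) k) * x ^ k)"
proof -
  have "(1 - x) * rogers n x = rogers n x - x * rogers n x" by (simp add: left_diff_distrib)
  also have "\<dots> = (\<Sum>k\<le>Suc n. alt_conv qratio (shifted qratio) (Suc n) k * x ^ k) -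
      - (\<Sum>k\<le>Suc n. alt_conv (shifted qratio) qratio (Suc n) k * x ^ k)"
    by (subst rogers_shifts(2), subst rogers_shifts(1)) (rule refl)
  finally show ?thesis by (simp only: diff_minus_eq_add sum.distrib[symmetric] distrib_right)
qed

text \<open>
  This is \<open>x\<close> times the polynomial of degree \<open>n - 1\<close>, and 0 for \<open>n = 0\<close>.  The form below needs
  no case distinction and has the same summation range as the shifted forms of \<open>rogers n\<close>.
\<close>

definition rogers_lower :: "nat \<Rightarrow> complex \<Rightarrow> complex" where
  "rogers_lower n x = - (\<Sum>k\<le>Suc n. alt_conv (shifted qratio) (shifted qratio) (Suc n) k * x ^ k)"

lemma rogers_lower_0: "rogers_lower 0 x = 0"
  by (simp add: rogers_lower_def alt_conv_def)

lemma rogers_lower_Suc: "rogers_lower (Suc n) x = x * rogers n x"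
  unfolding rogers_lower_def rogers_shifts(2)
  using sum_alt_conv_shift_right[of "shifted qratio" qratio "Suc n" x "\<lambda>_. 1"] by simp

lemma alt_conv_eq:
  assumes "k \<le> n"
  shows "alt_conv qratio qratio n k = (1 + q ^ k) * (1 + q ^ (n - k)) * alt_conv \<beta> \<beta> n k"
    "alt_conv qratio (shifted qratio) n k = (1 + q ^ k) * (1 - q ^ (n - k)) * alt_conv \<beta> \<beta> n k"
    "alt_conv (shifted qratio) qratio n k = (1 - q ^ k) * (1 + q ^ (n - k)) * alt_conv \<beta> \<beta> n k"
    "alt_conv (shifted qratio) (shifted qratio) n k = (1 - q ^ k) * (1 - q ^ (n - k)) * alt_conv \<beta> \<beta> n k"
  unfolding alt_conv_def shifted_qratio_eq qratio_eq by simp_all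

text \<open>
  Rogers' three-term recurrence, coefficient by coefficient: all four coefficients of \<open>x\<^sup>k\<close> are
  the same number times a product of factors \<open>1 \<plusminus> q\<^sup>k\<close> and \<open>1 \<plusminus> q\<^sup>n\<^sup>+\<^sup>1\<^sup>-\<^sup>k\<close>.
\<close>

lemma rogers_recurrence:
  "(1 - q ^ Suc n) * (rogers (Suc n) x - rogers_lower n x) = (1 + q ^ Suc n) * ((1 - x) * rogers n x)"
proof -
  have 1: "(1 - q ^ Suc n) * (rogers (Suc n) x - rogers_lower n x) =
    (\<Sum>k\<le>Suc n. (1 - q ^ Suc n) * (alt_conv qratio qratio (Suc n) k + alt_conv (shifted qratio) (shifted qratio) (Suc n) k) * x ^ k)"
    unfolding rogers_Suc rogers_lower_def by (simp only: diff_minus_eq_add sum.distrib[symmetric] sum_distrib_left ring_distribs mult.assoc)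
  have 2: "(1 + q ^ Suc n) * ((1 - x) * rogers n x) =
    (\<Sum>k\<le>Suc n. (1 + q ^ Suc n) * (alt_conv qratio (shifted qratio) (Suc n) k + alt_conv (shifted qratio) qratio (Suc n) k) * x ^ k)"
    unfolding one_minus_mult_rogers by (simp only: sum_distrib_left mult.assoc)
  show ?thesis unfolding 1 2
  proof (intro sum.cong refl)
    fix k assume "k \<in> {..Suc n}"
    then have k: "k \<le> Suc n" by simp
    then have q: "q ^ Suc n = q ^ k * q ^ (Suc n - k)" by (simp flip: power_add)
    show "(1 - q ^ Suc n) * (alt_conv qratio qratio (Suc n) k + alt_conv (shifted qratio) (shifted qratio) (Suc n) k) * x ^ k =
      (1 + q ^ Suc n) * (alt_conv qratio (shifted qratio) (Suc n) k + alt_conv (shifted qratio) qratio (Suc n) k) * x ^ k"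
      unfolding alt_conv_eq[OF k] q by (simp add: algebra_simps)
  qed
qed

definition rogers_pair_sum :: "nat \<Rightarrow> complex \<Rightarrow> complex \<Rightarrow> complex" where
  "rogers_pair_sum n x y = (\<Sum>k\<le>n. \<Sum>l\<le>n. alt_conv qratio qratio n k * x ^ k * (alt_conv qratio qratio n l * y ^ l) * ((q ^ l - q ^ k) / (q ^ l + q ^ k)))"

text \<open>
  The kernel is unchanged when both indices grow by one.  So multiplication by \<open>x y - 1\<close> subtracts the
  products of weights at \<open>(k, l)\<close> from those at \<open>(k - 1, l - 1)\<close> under a common kernel value, and this
  difference contains the denominator \<open>q\<^sup>k + q\<^sup>l\<close> as a factor.
\<close>

lemma rogers_pair_sum_formula:
  "(x * y - 1) * rogers_pair_sum n x y = rogers_lower n y * ((x - 1) * rogers n x) - rogers_lower n x * ((y - 1) * rogers n y)"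
proof -
  let ?N = "Suc n" and ?K = "\<lambda>k l. (q ^ l - q ^ k) / (q ^ l + q ^ k)"
  have F: "rogers_pair_sum n x y = (\<Sum>k\<le>n. alt_conv qratio qratio n k * x ^ k * (\<Sum>l\<le>n. alt_conv qratio qratio n l * y ^ l * ?K k l))"
    unfolding rogers_pair_sum_def by (simp only: sum_distrib_left mult.assoc)
  have lo: "rogers_pair_sum n x y = (\<Sum>k\<le>?N. \<Sum>l\<le>?N. alt_conv qratio (shifted qratio) ?N k * alt_conv qratio (shifted qratio) ?N l * ?K k l * (x ^ k * y ^ l))"
    unfolding F sum_alt_conv_shift_right[of _ _ n] by (simp only: sum_distrib_left mult_ac)
  have K: "?K (Suc k) (Suc l) = ?K k l" for k l
  proof -
    have "?K (Suc k) (Suc l) = (q * (q ^ l - q ^ k)) / (q * (q ^ l + q ^ k))"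
      by (simp add: algebra_simps)
    then show ?thesis using q_nonzero by simp
  qed
  have s: "(\<Sum>l\<le>n. alt_conv qratio qratio n l * y ^ l * ?K k l) * y = - (\<Sum>l\<le>?N. alt_conv (shifted qratio) qratio ?N l * y ^ l * ?K (Suc k) l)" for k
    using sum_alt_conv_shift_left[of qratio qratio n y "?K (Suc k)"] unfolding K .
  have "x * y * rogers_pair_sum n x y = (\<Sum>k\<le>n. alt_conv qratio qratio n k * x ^ k * ((\<Sum>l\<le>n. alt_conv qratio qratio n l * y ^ l * ?K k l) * y)) * x"
    unfolding F by (simp only: sum_distrib_left sum_distrib_right mult_ac)
  also have "\<dots> = (\<Sum>k\<le>?N. alt_conv (shifted qratio) qratio ?N k * x ^ k * (\<Sum>l\<le>?N. alt_conv (shifted qratio) qratio ?N l * y ^ l * ?K k l))"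
    unfolding s using sum_alt_conv_shift_left[of qratio qratio n x "\<lambda>k. - (\<Sum>l\<le>?N. alt_conv (shifted qratio) qratio ?N l * y ^ l * ?K k l)"]
    by (simp only: mult_minus_right sum_negf minus_minus)
  also have "\<dots> = (\<Sum>k\<le>?N. \<Sum>l\<le>?N. alt_conv (shifted qratio) qratio ?N k * alt_conv (shifted qratio) qratio ?N l * ?K k l * (x ^ k * y ^ l))"
    by (simp only: sum_distrib_left mult_ac)
  finally have "(x * y - 1) * rogers_pair_sum n x y =
     (\<Sum>k\<le>?N. \<Sum>l\<le>?N. (alt_conv (shifted qratio) qratio ?N k * alt_conv (shifted qratio) qratio ?N l -
        alt_conv qratio (shifted qratio) ?N k * alt_conv qratio (shifted qratio) ?N l) * ?K k l * (x ^ k * y ^ l))"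
    unfolding left_diff_distrib sum_subtractf mult_1_left lo[symmetric] by (simp only:)
  also have "\<dots> = (\<Sum>k\<le>?N. \<Sum>l\<le>?N.
       (alt_conv (shifted qratio) (shifted qratio) ?N l * (alt_conv (shifted qratio) qratio ?N k + alt_conv qratio (shifted qratio) ?N k) -
        alt_conv (shifted qratio) (shifted qratio) ?N k * (alt_conv (shifted qratio) qratio ?N l + alt_conv qratio (shifted qratio) ?N l)) * (x ^ k * y ^ l))"
  proof (intro sum.cong refl arg_cong2[of _ _ _ _ "(*)"])
    fix k l assume "k \<in> {..?N}" "l \<in> {..?N}"
    then have kl: "k \<le> ?N" "l \<le> ?N" by auto
    define M P where "M = q ^ (?N - k)" and "P = q ^ (?N - l)"
    have q: "q ^ k * M = q ^ l * P" using kl by (simp add: M_def P_def flip: power_add)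
    have nz: "q ^ l + q ^ k \<noteq> 0" by (rule q_power_add_nonzero)
    have "((1 - K) * (1 + M) * ((1 - L) * (1 + P)) - (1 + K) * (1 - M) * ((1 + L) * (1 - P))) * (L - K) =
      ((1 - L) * (1 - P) * ((1 - K) * (1 + M) + (1 + K) * (1 - M)) -
       (1 - K) * (1 - M) * ((1 - L) * (1 + P) + (1 + L) * (1 - P))) * (L + K)"
      if "K * M = L * P" for K L :: complex
      using that by algebra
    from this[OF q] have "((1 - q^k) * (1 + M) * ((1 - q^l) * (1 + P)) - (1 + q^k) * (1 - M) * ((1 + q^l) * (1 - P))) * ?K k l =
      ((1 - q^l) * (1 - P) * ((1 - q^k) * (1 + M) + (1 + q^k) * (1 - M)) -
       (1 - q^k) * (1 - M) * ((1 - q^l) * (1 + P) + (1 + q^l) * (1 - P)))" (is "?A = ?B")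
      using nz by (simp add: nonzero_divide_eq_eq)
    then have "?A * (alt_conv \<beta> \<beta> ?N k * alt_conv \<beta> \<beta> ?N l) = ?B * (alt_conv \<beta> \<beta> ?N k * alt_conv \<beta> \<beta> ?N l)"
      by simp
    then show "(alt_conv (shifted qratio) qratio ?N k * alt_conv (shifted qratio) qratio ?N l -
        alt_conv qratio (shifted qratio) ?N k * alt_conv qratio (shifted qratio) ?N l) * ?K k l =
       alt_conv (shifted qratio) (shifted qratio) ?N l * (alt_conv (shifted qratio) qratio ?N k + alt_conv qratio (shifted qratio) ?N k) -
        alt_conv (shifted qratio) (shifted qratio) ?N k * (alt_conv (shifted qratio) qratio ?N l + alt_conv qratio (shifted qratio) ?N l)"
      unfolding alt_conv_eq[OF kl(1)] alt_conv_eq[OF kl(2)] M_def[symmetric] P_def[symmetric]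
      by (simp only: ring_distribs mult_ac)
  qed
  also have "\<dots> = rogers_lower n y * ((x - 1) * rogers n x) - rogers_lower n x * ((y - 1) * rogers n y)"
  proof -
    have d: "(z - 1) * rogers n z = - (\<Sum>k\<le>?N. (alt_conv (shifted qratio) qratio ?N k + alt_conv qratio (shifted qratio) ?N k) * z ^ k)" for z
      using one_minus_mult_rogers[of z n] by (simp add: algebra_simps)
    show ?thesis
      unfolding rogers_lower_def d minus_mult_minus
      unfolding left_diff_distrib sum_subtractf sum_product
      by (subst sum.swap[of _ "{..?N}" "{..?N}"]) (simp only: mult_ac)
  qed
  finally show ?thesis .
qed

end

section \<open>The basic hypergeometric side in one and two variables\<close>

text \<open>
  The coefficient comparison behind the two-variable formula, with \<open>K = q\<^sup>k\<close>, \<open>L = q\<^sup>l\<close> and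
  \<open>M = q\<^sup>n\<^sup>+\<^sup>1\<close>.  The terms with the denominator \<open>1 - q K L\<close> combine, because
  \<open>(1 - q K\<^sup>2) / K + (1 - q L\<^sup>2) / L\<close> contains that factor.
\<close>

lemma aw_coefficient_identity:
  fixes K L M q :: complex
  assumes nz: "K \<noteq> 0" "L \<noteq> 0" "M \<noteq> 0" "q \<noteq> 0" "1 - K * L \<noteq> 0" "1 - q * (K * L) \<noteq> 0"
  defines "A k \<equiv> (1 - k / M) * (1 - M * k)"
  shows "A L * ((1 - q * K\<^sup>2) / K * ((1 - K)\<^sup>2 * ((q * L - K) / (1 - K * L)) - q * A K * ((L - K) / (1 - q * (K * L)))))
    - A K * ((1 - q * L\<^sup>2) / L * ((1 - L)\<^sup>2 * ((q * K - L) / (1 - K * L)) - q * A L * ((K - L) / (1 - q * (K * L)))))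
    = M * ((1 - K / M) * (1 - q * K / M) * ((1 - q * L\<^sup>2) * (1 - M)\<^sup>2 / M)
          - (1 - L / M) * (1 - q * L / M) * ((1 - q * K\<^sup>2) * (1 - M)\<^sup>2 / M))" (is "?lhs = ?rhs")
proof -
  define a where "a k = (M - k) * (1 - M * k)" for k
  define D where "D = (L - K) / (1 - q * (K * L))"
  define W where "W = 1 - K * L"
  have A: "A k = a k / M" for k using nz by (simp add: A_def a_def field_simps)
  have D': "(K - L) / (1 - q * (K * L)) = - D" by (simp add: D_def minus_divide_left)
  have *: "D * ((1 - q * K\<^sup>2) / K + (1 - q * L\<^sup>2) / L) = (L - K) * (K + L) / (K * L)"
  proof -
    have "(1 - q * K\<^sup>2) / K + (1 - q * L\<^sup>2) / L = (1 - q * (K * L)) * ((K + L) / (K * L))"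
      using nz(1,2) by (simp add: field_simps power2_eq_square)
    then show ?thesis using nz(6) by (simp add: D_def)
  qed
  have "?lhs = a L / M * (1 - q * K\<^sup>2) / K * (1 - K)\<^sup>2 * (q * L - K) / W
     - a K / M * (1 - q * L\<^sup>2) / L * (1 - L)\<^sup>2 * (q * K - L) / W
     - q * (a K / M) * (a L / M) * (D * ((1 - q * K\<^sup>2) / K + (1 - q * L\<^sup>2) / L))"
    unfolding A D' D_def[symmetric] W_def[symmetric] by (simp add: divide_inverse algebra_simps)
  also have "\<dots> = (M * a L * (1 - q * K\<^sup>2) * (1 - K)\<^sup>2 * (q * L - K) * L
     - M * a K * (1 - q * L\<^sup>2) * (1 - L)\<^sup>2 * (q * K - L) * K
     - q * a K * a L * ((L - K) * (K + L)) * W) / (W * K * L * M\<^sup>2)"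
    unfolding * using nz(1-3) nz(5)[folded W_def]
    by (simp add: divide_simps power2_eq_square) (simp add: algebra_simps)
  also have "M * a L * (1 - q * K\<^sup>2) * (1 - K)\<^sup>2 * (q * L - K) * L
     - M * a K * (1 - q * L\<^sup>2) * (1 - L)\<^sup>2 * (q * K - L) * K
     - q * a K * a L * ((L - K) * (K + L)) * W
     = W * K * L * ((1 - M)\<^sup>2 * ((M - K) * (M - q * K) * (1 - q * L\<^sup>2) - (M - L) * (M - q * L) * (1 - q * K\<^sup>2)))"
    unfolding a_def W_def by algebra
  also have "\<dots> / (W * K * L * M\<^sup>2) =
     (1 - M)\<^sup>2 * ((M - K) * (M - q * K) * (1 - q * L\<^sup>2) - (M - L) * (M - q * L) * (1 - q * K\<^sup>2)) / M\<^sup>2"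
    using nz(1,2) nz(5)[folded W_def] by simp
  also have "\<dots> = ?rhs"
  proof -
    have e: "(1 - k / M) * (1 - q * k / M) = (M - k) * (M - q * k) / M\<^sup>2" for k
      using nz(3) by (simp add: field_simps power2_eq_square)
    have "V * (X * Y - X' * Y') / M\<^sup>2 = M * (X / M\<^sup>2 * (Y * V / M) - X' / M\<^sup>2 * (Y' * V / M))" for V X Y X' Y'
      using nz(3) by (simp add: field_simps)
    then show ?thesis unfolding e .
  qed
  finally show ?thesis .
qed

context generic_parameter
begin

text \<open>
  The part of a summand of the \<open>\<^sub>4\<phi>\<^sub>3\<close> series that does not involve the variable.
\<close>

definition aw_coeff :: "nat \<Rightarrow> nat \<Rightarrow> complex" where
  "aw_coeff n k = qpochs [q powi (- int n), q ^ (n + 2)] q k / qpochs [q, q, r ^ 3, - (r ^ 3)] q k * q ^ k"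

text \<open>
  For \<open>s \<noteq> 0\<close> a polynomial of degree \<open>k\<close> in \<open>aw_var s = s - 1 / s\<close>, of Askey-Wilson type.
\<close>

definition aw_basis :: "complex \<Rightarrow> nat \<Rightarrow> complex" where
  "aw_basis s k = qpoch (r / s) q k * qpoch (- (r * s)) q k"

definition aw_var :: "complex \<Rightarrow> complex" where
  "aw_var s = s - 1 / s"

definition aw_sum :: "nat \<Rightarrow> complex \<Rightarrow> complex" where
  "aw_sum n s = (\<Sum>k\<le>n. aw_coeff n k * aw_basis s k)"

text \<open>
  The analogue of \<open>\<beta>\<close> here: a common factor of the coefficients at \<open>(n, k)\<close>, \<open>(n, k - 1)\<close>,
  \<open>(n + 1, k)\<close> and \<open>(n - 1, k)\<close> with explicit cofactors
  that remain correct at the boundary values \<open>k = 0\<close> and \<open>k = n + 1\<close>.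
\<close>

definition aw_core :: "nat \<Rightarrow> nat \<Rightarrow> complex" where
  "aw_core n k = (case k of 0 \<Rightarrow> 1 / ((1 - 1 / q ^ Suc n) * (1 - q ^ Suc n) * q)
     | Suc j \<Rightarrow> aw_coeff n j / ((1 - q ^ k)\<^sup>2 * (1 - q * (q ^ k)\<^sup>2)))"

text \<open>
  A multiple of the series of degree \<open>n - 1\<close>, written so that it is 0 for \<open>n = 0\<close>.
\<close>

definition aw_sum_lower :: "nat \<Rightarrow> complex \<Rightarrow> complex" where
  "aw_sum_lower n s = (\<Sum>k\<le>Suc n. - (q ^ Suc n) * (1 - q ^ Suc n) * (1 - q ^ k / q ^ Suc n) *
      (1 - q * q ^ k / q ^ Suc n) * aw_core n k * aw_basis s k)"

lemma one_minus_q_power: "1 - q ^ Suc k \<noteq> 0"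
  using q_not_root_of_unity[of "Suc k"] by simp

lemma one_minus_q_power_odd: "1 - q * (q ^ k)\<^sup>2 \<noteq> 0"
proof -
  have "q * (q ^ k)\<^sup>2 = q ^ Suc (k * 2)" by (simp add: power_mult)
  then show ?thesis by (metis one_minus_q_power)
qed

lemma powi_minus: "q powi (- int n) = 1 / q ^ n"
  by (simp add: power_int_minus divide_inverse)

lemma aw_coeff_alt:
  "aw_coeff n k = qpochs [1 / q ^ n, q ^ (n + 2)] q k / qpochs [q, q, r ^ 3, - (r ^ 3)] q k * q ^ k"
  by (simp only: aw_coeff_def powi_minus)

lemma cube_factors: "(1 - r ^ 3 * q ^ k) * (1 + r ^ 3 * q ^ k) = 1 - q * (q ^ Suc k)\<^sup>2"
proof -
  have "(1 - r ^ 3 * q ^ k) * (1 + r ^ 3 * q ^ k) = 1 - (r\<^sup>2) ^ 3 * (q ^ k)\<^sup>2"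
    by (simp add: algebra_simps power2_eq_square power3_eq_cube)
  also have "\<dots> = 1 - q * (q ^ Suc k)\<^sup>2"
    unfolding sqrt_q by (simp add: power2_eq_square power3_eq_cube mult_ac)
  finally show ?thesis .
qed

lemma aw_coeff_0 [simp]: "aw_coeff n 0 = 1"
  by (simp add: aw_coeff_def qpochs_def)

lemma aw_coeff_Suc:
  "aw_coeff n (Suc k) = aw_coeff n k * ((1 - q ^ k / q ^ n) * (1 - q ^ (n + 2) * q ^ k) * q
     / ((1 - q ^ Suc k)\<^sup>2 * (1 - q * (q ^ Suc k)\<^sup>2)))"
  unfolding cube_factors[symmetric] by (simp add: aw_coeff_alt qpochs_def qpoch_Suc power2_eq_square mult_ac)

lemma aw_coeff_eq_0: "k > n \<Longrightarrow> aw_coeff n k = 0"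
  using q_nonzero by (auto simp: aw_coeff_def qpochs_def powi_minus qpoch_def)

lemma shifted_aw_coeff_eq: "shifted (aw_coeff n) k = (1 - q ^ k)\<^sup>2 * (1 - q * (q ^ k)\<^sup>2) * aw_core n k"
proof (cases k)
  case (Suc j)
  then show ?thesis using one_minus_q_power[of j] one_minus_q_power_odd[of k] by (simp add: aw_core_def)
qed simp

lemma one_minus_inverse_q_power: "1 - 1 / q ^ Suc n \<noteq> 0"
proof
  assume "1 - 1 / q ^ Suc n = 0"
  then have "1 / q ^ Suc n = 1" by simp
  then have "q ^ Suc n = 1" by (simp only: divide_eq_1_iff)
  then show False using one_minus_q_power[of n] by simp
qed

lemma aw_coeff_eq: "aw_coeff n k = (1 - q ^ k / q ^ Suc n) * (1 - q ^ Suc n * q ^ k) * q * aw_core n k"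
proof (cases k)
  case 0
  then show ?thesis
    using one_minus_q_power[of n] one_minus_inverse_q_power[of n] q_nonzero by (simp add: aw_core_def del: power_Suc)
next
  case (Suc j)
  have "q ^ Suc j / q ^ Suc n = q ^ j / q ^ n" "q ^ Suc n * q ^ Suc j = q ^ (n + 2) * q ^ j"
    using q_nonzero by simp_all
  then show ?thesis unfolding Suc aw_coeff_Suc by (simp add: aw_core_def del: power_Suc)
qed

text \<open>
  At \<open>k = n + 1\<close> the coefficient of the series for \<open>n\<close> is 0, while the one for \<open>n + 1\<close> is not.  So the latter
  is compared with the coefficient at \<open>(n, k - 1)\<close>, from which \<open>aw_core\<close> is built.
\<close>

lemma aw_coeff_upper_eq:
  "(1 - q ^ (n + 2)) * aw_coeff (Suc n) k =
     q * (1 - q ^ Suc n * q ^ k) * (1 - q ^ (n + 2) * q ^ k) * (1 - 1 / q ^ Suc n) * aw_core n k"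
proof (cases k)
  case 0
  then show ?thesis
    using one_minus_q_power[of n] one_minus_inverse_q_power[of n] q_nonzero by (simp add: aw_core_def del: power_Suc)
next
  case (Suc j)
  have 1: "qpoch (1 / q ^ Suc n) q (Suc j) = (1 - 1 / q ^ Suc n) * qpoch (1 / q ^ n) q j"
    using q_nonzero by (simp add: qpoch_Suc_front)
  have 2: "(1 - q ^ (n + 2)) * qpoch (q ^ (Suc n + 2)) q (Suc j) =
      qpoch (q ^ (n + 2)) q j * (1 - q ^ (n + 2) * q ^ j) * (1 - q ^ (n + 2) * q ^ Suc j)"
    using qpoch_shift[of "q ^ (n + 2)" q j] by (simp add: qpoch_Suc mult_ac)
  have "(1 - q ^ (n + 2)) * aw_coeff (Suc n) (Suc j) = qpoch (1 / q ^ Suc n) q (Suc j) *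
      ((1 - q ^ (n + 2)) * qpoch (q ^ (Suc n + 2)) q (Suc j)) /
      qpochs [q, q, r ^ 3, - (r ^ 3)] q (Suc j) * q ^ Suc j"
    by (simp only: aw_coeff_alt qpochs_def list.map prod_list.Cons prod_list.Nil mult_1_right mult_1_left
       times_divide_eq_right times_divide_eq_left mult_ac)
  also have "\<dots> = aw_coeff n j / ((1 - q ^ Suc j)\<^sup>2 * ((1 - r ^ 3 * q ^ j) * (1 + r ^ 3 * q ^ j))) *
      (q * (1 - 1 / q ^ Suc n) * (1 - q ^ (n + 2) * q ^ j) * (1 - q ^ (n + 2) * q ^ Suc j))"
    unfolding 1 2 by (simp add: aw_coeff_alt qpochs_def qpoch_Suc[of q] qpoch_Suc[of "r ^ 3"]
        qpoch_Suc[of "- (r ^ 3)"] power2_eq_square mult_ac)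
  also have "q ^ (n + 2) * q ^ j = q ^ Suc n * q ^ Suc j" by simp
  finally show ?thesis unfolding Suc cube_factors by (simp add: aw_core_def mult_ac del: power_Suc)
qed

lemma aw_coeff_lower_eq:
  "(1 - q ^ Suc n) * aw_coeff n k =
     - (q ^ Suc (Suc n)) * (1 - q ^ Suc (Suc n)) * (1 - q ^ k / q ^ Suc (Suc n)) *
      (1 - q * q ^ k / q ^ Suc (Suc n)) * aw_core (Suc n) k"
proof (cases k)
  case 0
  have "- (q ^ Suc (Suc n) * (1 - q / q ^ Suc (Suc n)) / q) = 1 - q ^ Suc n"
    using q_nonzero by (simp add: field_simps)
  then show ?thesis
    using one_minus_q_power[of "Suc n"] one_minus_inverse_q_power[of "Suc n"] q_nonzero
    unfolding 0 by (simp add: aw_core_def mult_ac del: power_Suc)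
next
  case (Suc j)
  let ?m = "Suc n"
  have 1: "(1 - 1 / q ^ ?m) * qpoch (1 / q ^ n) q (Suc j) =
      qpoch (1 / q ^ ?m) q j * (1 - q ^ j / q ^ ?m) * (1 - q ^ Suc j / q ^ ?m)"
    using qpoch_shift[of "1 / q ^ ?m" q "Suc j"] q_nonzero by (simp add: qpoch_Suc)
  have 2: "qpoch (q ^ (n + 2)) q (Suc j) = (1 - q ^ (n + 2)) * qpoch (q ^ (?m + 2)) q j"
    by (simp add: qpoch_Suc_front mult_ac)
  have 3: "1 - q ^ ?m = - (q ^ ?m) * (1 - 1 / q ^ ?m)" using q_nonzero by (simp add: field_simps)
  have "(1 - q ^ ?m) * aw_coeff n (Suc j) = - (q ^ ?m) * (((1 - 1 / q ^ ?m) * qpoch (1 / q ^ n) q (Suc j)) *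
      qpoch (q ^ (n + 2)) q (Suc j) / qpochs [q, q, r ^ 3, - (r ^ 3)] q (Suc j) * q ^ Suc j)"
    unfolding 3 by (simp only: aw_coeff_alt qpochs_def list.map prod_list.Cons prod_list.Nil mult_1_right mult_1_left
       times_divide_eq_right times_divide_eq_left mult_ac)
  also have "\<dots> = aw_coeff ?m j / ((1 - q ^ Suc j)\<^sup>2 * ((1 - r ^ 3 * q ^ j) * (1 + r ^ 3 * q ^ j))) *
      (- (q ^ Suc ?m) * (1 - q ^ (n + 2)) * (1 - q ^ j / q ^ ?m) * (1 - q ^ Suc j / q ^ ?m))"
    unfolding 1 2 by (simp add: aw_coeff_alt qpochs_def qpoch_Suc[of q] qpoch_Suc[of "r ^ 3"]
        qpoch_Suc[of "- (r ^ 3)"] power2_eq_square mult_ac)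
  also have "q ^ j / q ^ ?m = q ^ Suc j / q ^ Suc ?m"
    using q_nonzero by simp
  also have "q ^ Suc j / q ^ ?m = q * q ^ Suc j / q ^ Suc ?m"
    using q_nonzero by simp
  finally show ?thesis unfolding Suc cube_factors by (simp add: aw_core_def mult_ac del: power_Suc)
qed

lemma aw_sum_lower_0: "aw_sum_lower 0 s = 0"
  by (simp add: aw_sum_lower_def)

lemma aw_sum_lower_Suc: "aw_sum_lower (Suc n) s = (1 - q ^ Suc n) * aw_sum n s"
  unfolding aw_sum_lower_def aw_coeff_lower_eq[symmetric] by (simp add: aw_sum_def aw_coeff_eq_0 sum_distrib_left mult.assoc)

lemma aw_basis_Suc: "s \<noteq> 0 \<Longrightarrow> aw_basis s (Suc k) = aw_basis s k * (1 - q * (q ^ k)\<^sup>2 + r * q ^ k * aw_var s)"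
  using sqrt_q by (simp add: aw_basis_def qpoch_Suc aw_var_def field_simps power2_eq_square)

lemma aw_var_mult_basis:
  assumes "s \<noteq> 0"
  shows "aw_var s * aw_basis s k = r / q ^ Suc k * aw_basis s (Suc k) - (1 - q * (q ^ k)\<^sup>2) / (r * q ^ k) * aw_basis s k"
proof -
  have "r / q ^ Suc k = 1 / (r * q ^ k)"
    using r_nonzero q_nonzero by (simp add: field_simps flip: sqrt_q power2_eq_square)
  show ?thesis
    unfolding aw_basis_Suc[OF assms] \<open>r / q ^ Suc k = _\<close> using r_nonzero q_nonzero by (simp add: field_simps)
qed

lemma aw_var_mult_sum:
  assumes "s \<noteq> 0" "g (Suc n) = 0"
  shows "aw_var s * (\<Sum>k\<le>n. g k * aw_basis s k) =
    (\<Sum>k\<le>Suc n. (r / q ^ k * shifted g k - (1 - q * (q ^ k)\<^sup>2) / (r * q ^ k) * g k) * aw_basis s k)"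
proof -
  have "aw_var s * (\<Sum>k\<le>n. g k * aw_basis s k) = (\<Sum>k\<le>n. g k * (aw_var s * aw_basis s k))"
    by (simp add: sum_distrib_left mult_ac)
  also have "\<dots> = (\<Sum>k\<le>n. r / q ^ Suc k * shifted g (Suc k) * aw_basis s (Suc k)) -
      (\<Sum>k\<le>n. (1 - q * (q ^ k)\<^sup>2) / (r * q ^ k) * g k * aw_basis s k)"
    unfolding aw_var_mult_basis[OF assms(1)] shifted.simps sum_subtractf[symmetric]
    by (simp only: right_diff_distrib mult_ac)
  also have "(\<Sum>k\<le>n. r / q ^ Suc k * shifted g (Suc k) * aw_basis s (Suc k)) =
      (\<Sum>k\<le>Suc n. r / q ^ k * shifted g k * aw_basis s k)"
    by (simp only: sum.atMost_Suc_shift shifted.simps mult_zero_right mult_zero_left add_0)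
  also have "(\<Sum>k\<le>n. (1 - q * (q ^ k)\<^sup>2) / (r * q ^ k) * g k * aw_basis s k) =
     (\<Sum>k\<le>Suc n. (1 - q * (q ^ k)\<^sup>2) / (r * q ^ k) * g k * aw_basis s k)"
    by (simp add: assms)
  finally show ?thesis by (simp only: left_diff_distrib sum_subtractf)
qed

lemma r_divide_q: "q / r = r"
  using r_nonzero by (simp add: field_simps flip: sqrt_q power2_eq_square)

text \<open>
  The coefficients of \<open>aw_var s\<close> times the series simplify to a product, because the numerator
  \<open>(1 - K)\<^sup>2 - (1 - K / M) (1 - M K)\<close> is \<open>K (1 - M)\<^sup>2 / M\<close>.
\<close>

lemma aw_var_mult_coeff:
  "r / q ^ k * shifted (aw_coeff n) k - (1 - q * (q ^ k)\<^sup>2) / (r * q ^ k) * aw_coeff n k =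
     r * (1 - q * (q ^ k)\<^sup>2) * (1 - q ^ Suc n)\<^sup>2 / q ^ Suc n * aw_core n k"
proof -
  define K M where "K = q ^ k" and "M = q ^ Suc n"
  have nz: "K \<noteq> 0" "M \<noteq> 0" using q_nonzero by (simp_all add: K_def M_def)
  have "(1 - K)\<^sup>2 - (1 - K / M) * (1 - M * K) = (1 - M)\<^sup>2 / M * K"
    using nz by (simp add: field_simps power2_eq_square)
  then have *: "((1 - K)\<^sup>2 - (1 - K / M) * (1 - M * K)) / K = (1 - M)\<^sup>2 / M"
    using nz by simp
  have "r / K * shifted (aw_coeff n) k - (1 - q * K\<^sup>2) / (r * K) * aw_coeff n k =
     (1 - q * K\<^sup>2) * aw_core n k * (r * (1 - K)\<^sup>2 - q / r * ((1 - K / M) * (1 - M * K))) / K"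
    unfolding shifted_aw_coeff_eq aw_coeff_eq K_def[symmetric] M_def[symmetric]
    using nz r_nonzero by (simp add: field_simps)
  also have "\<dots> = (1 - q * K\<^sup>2) * aw_core n k * r * (((1 - K)\<^sup>2 - (1 - K / M) * (1 - M * K)) / K)"
    unfolding r_divide_q by (simp add: right_diff_distrib diff_divide_distrib mult_ac)
  finally show ?thesis unfolding * by (simp add: K_def M_def mult_ac)
qed

lemma aw_var_mult_aw_sum:
  assumes "s \<noteq> 0"
  shows "aw_var s * aw_sum n s = (\<Sum>k\<le>Suc n. r * (1 - q * (q ^ k)\<^sup>2) * (1 - q ^ Suc n)\<^sup>2 / q ^ Suc n * aw_core n k * aw_basis s k)"
  unfolding aw_sum_def aw_var_mult_sum[OF assms, where g = "aw_coeff n" and n = n, OF aw_coeff_eq_0[OF lessI]] aw_var_mult_coeff ..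

lemma aw_sum_recurrence:
  assumes "s \<noteq> 0"
  shows "(1 - q ^ (n + 2)) * aw_sum (Suc n) s / r - r * aw_sum_lower n s = - (1 + q ^ Suc n) * (aw_var s * aw_sum n s)"
proof -
  have 1: "(1 - q ^ (n + 2)) * aw_sum (Suc n) s = (\<Sum>k\<le>Suc n.
     q * (1 - q ^ Suc n * q ^ k) * (1 - q ^ (n + 2) * q ^ k) * (1 - 1 / q ^ Suc n) * aw_core n k * aw_basis s k)"
    unfolding aw_coeff_upper_eq[symmetric] by (simp only: aw_sum_def sum_distrib_left mult.assoc)
  show ?thesis
    unfolding 1 aw_var_mult_aw_sum[OF assms] aw_sum_lower_def sum_distrib_left sum_divide_distrib sum_subtractf[symmetric]
  proof (intro sum.cong refl)
    fix k
    define K M where "K = q ^ k" and "M = q ^ Suc n"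
    have nz: "K \<noteq> 0" "M \<noteq> 0" using q_nonzero by (simp_all add: K_def M_def)
    have qM: "q ^ (n + 2) = q * M" by (simp add: M_def)
    have key: "(1 - M * K) * (1 - q * M * K) * (1 - 1 / M) + M * (1 - M) * (1 - K / M) * (1 - q * K / M) =
        - (1 + M) * ((1 - q * K\<^sup>2) * (1 - M)\<^sup>2 / M)"
      using nz by (simp add: divide_simps) algebra
    have "q * (1 - M * K) * (1 - q * M * K) * (1 - 1 / M) * aw_core n k * aw_basis s k / r =
        q / r * ((1 - M * K) * (1 - q * M * K) * (1 - 1 / M) * (aw_core n k * aw_basis s k))"
      by (simp only: times_divide_eq_left times_divide_eq_right mult_ac)
    note t1 = this[unfolded r_divide_q]
    have t2: "r * (- M * (1 - M) * (1 - K / M) * (1 - q * K / M) * aw_core n k * aw_basis s k) =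
        - (r * (M * (1 - M) * (1 - K / M) * (1 - q * K / M) * (aw_core n k * aw_basis s k)))"
      by (simp only: mult_minus_left mult_minus_right mult_ac)
    have t3: "- (1 + M) * (r * (1 - q * K\<^sup>2) * (1 - M)\<^sup>2 / M * aw_core n k * aw_basis s k) =
        r * (- (1 + M) * ((1 - q * K\<^sup>2) * (1 - M)\<^sup>2 / M) * (aw_core n k * aw_basis s k))"
      by (simp only: times_divide_eq_left times_divide_eq_right mult_ac)
    show "q * (1 - q ^ Suc n * q ^ k) * (1 - q ^ (n + 2) * q ^ k) * (1 - 1 / q ^ Suc n) * aw_core n k * aw_basis s k / r -
       r * (- (q ^ Suc n) * (1 - q ^ Suc n) * (1 - q ^ k / q ^ Suc n) * (1 - q * q ^ k / q ^ Suc n) * aw_core n k * aw_basis s k) =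
       - (1 + q ^ Suc n) * (r * (1 - q * (q ^ k)\<^sup>2) * (1 - q ^ Suc n)\<^sup>2 / q ^ Suc n * aw_core n k * aw_basis s k)"
      unfolding qM K_def[symmetric] M_def[symmetric] t1 t2 t3 key[symmetric]
      by (simp only: diff_minus_eq_add distrib_left[symmetric] distrib_right[symmetric])
  qed
qed

text \<open>
  The case of one variable.  The recurrences of the two families agree after rescaling, because
  \<open>1 - s\<^sup>2 = - s (s - 1 / s)\<close>.
\<close>

lemma rogers_eq_aw_sum:
  assumes "s \<noteq> 0"
  shows "rogers n (s\<^sup>2) = (s / r) ^ n * ((1 - q ^ Suc n) / (1 - q)) * aw_sum n s"
    and "rogers_lower n (s\<^sup>2) = s * r * (s / r) ^ n * aw_sum_lower n s / (1 - q)"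
proof -
  have q1: "1 - q \<noteq> 0" using one_minus_q_power[of 0] by simp
  have low: "rogers_lower n (s\<^sup>2) = s * r * (s / r) ^ n * aw_sum_lower n s / (1 - q)"
    if "\<And>i. n = Suc i \<Longrightarrow> rogers i (s\<^sup>2) = (s / r) ^ i * ((1 - q ^ Suc i) / (1 - q)) * aw_sum i s" for n
  proof (cases n)
    case 0
    then show ?thesis by (simp add: rogers_lower_0 aw_sum_lower_0)
  next
    case (Suc i)
    then show ?thesis using that[OF Suc] r_nonzero
      by (simp add: rogers_lower_Suc aw_sum_lower_Suc power2_eq_square field_simps)
  qed
  have C: "rogers n (s\<^sup>2) = (s / r) ^ n * ((1 - q ^ Suc n) / (1 - q)) * aw_sum n s" for n
  proof (induction n rule: less_induct)
    case (less n)
    show ?case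
    proof (cases n)
      case 0
      then show ?thesis using q1 by (simp add: rogers_def alt_conv_def qratio_def aw_sum_def aw_basis_def)
    next
      case (Suc i)
      define M where "M = q ^ Suc i"
      have M: "1 - M \<noteq> 0" unfolding M_def by (rule one_minus_q_power)
      have su: "1 - s\<^sup>2 = - s * aw_var s" using assms by (simp add: aw_var_def power2_eq_square field_simps)
      have "rogers n (s\<^sup>2) - rogers_lower i (s\<^sup>2) = (1 + M) * ((1 - s\<^sup>2) * rogers i (s\<^sup>2)) / (1 - M)"
        using rogers_recurrence[of i "s\<^sup>2"] M unfolding Suc M_def by (simp add: field_simps)
      also have "\<dots> = (s / r) ^ i * s / (1 - q) * (- (1 + M) * (aw_var s * aw_sum i s))"
      proof -
        have "(1 + M) * (- s * U * (Z * ((1 - M) / Q) * Y)) / (1 - M) = Z * s / Q * (- (1 + M) * (U * Y))"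
          for U Z Y Q using M by (cases "Q = 0") (simp_all add: field_simps)
        then show ?thesis unfolding su less.IH[of i, unfolded Suc, OF lessI] M_def[symmetric] .
      qed
      also have "- (1 + M) * (aw_var s * aw_sum i s) = (1 - q ^ (i + 2)) * aw_sum n s / r - r * aw_sum_lower i s"
        unfolding M_def Suc aw_sum_recurrence[OF assms] ..
      finally have "rogers n (s\<^sup>2) = (s / r) ^ i * s / (1 - q) * ((1 - q ^ (i + 2)) * aw_sum n s / r)"
        using low[of i] less.IH Suc by (simp add: algebra_simps diff_divide_distrib)
      then show ?thesis unfolding Suc using r_nonzero by (simp add: mult_ac)
    qed
  qed
  then show "rogers n (s\<^sup>2) = (s / r) ^ n * ((1 - q ^ Suc n) / (1 - q)) * aw_sum n s" .
  show "rogers_lower n (s\<^sup>2) = s * r * (s / r) ^ n * aw_sum_lower n s / (1 - q)"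
    by (rule low) (rule C)
qed

definition aw_pair_sum :: "nat \<Rightarrow> complex \<Rightarrow> complex \<Rightarrow> complex" where
  "aw_pair_sum n s t = (\<Sum>k\<le>n. \<Sum>l\<le>n. aw_coeff n k * aw_basis s k * (aw_coeff n l * aw_basis t l) * ((q ^ l - q ^ k) / (1 - q ^ (k + l + 1))))"

text \<open>
  Reduces multiplication by the second variable to multiplication by the first one.
\<close>

lemma aw_pair_sum_swap: "aw_pair_sum n s t = - aw_pair_sum n t s"
proof -
  let ?d = "\<lambda>k l. (q ^ l - q ^ k) / (1 - q ^ (k + l + 1))"
  have d: "?d k l = - ?d l k" for k l
    by (simp add: add.commute minus_divide_left)
  have "aw_pair_sum n t s = (\<Sum>k\<le>n. \<Sum>l\<le>n. aw_coeff n l * aw_basis t l * (aw_coeff n k * aw_basis s k) * ?d l k)"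
    unfolding aw_pair_sum_def by (rule sum.swap)
  also have "\<dots> = (\<Sum>k\<le>n. \<Sum>l\<le>n. - (aw_coeff n k * aw_basis s k * (aw_coeff n l * aw_basis t l) * ?d k l))"
    by (intro sum.cong refl, subst d) (simp only: mult_minus_right mult_ac)
  finally show ?thesis unfolding aw_pair_sum_def by (simp only: sum_negf minus_minus)
qed

lemma aw_var_mult_pair_sum:
  assumes "s \<noteq> 0"
  shows "aw_var s * aw_pair_sum n s t = (\<Sum>k\<le>Suc n. \<Sum>l\<le>Suc n.
      (r / q ^ k * shifted (\<lambda>k. aw_coeff n k * ((q ^ l - q ^ k) / (1 - q ^ (k + l + 1)))) k
       - (1 - q * (q ^ k)\<^sup>2) / (r * q ^ k) * (aw_coeff n k * ((q ^ l - q ^ k) / (1 - q ^ (k + l + 1))))) * aw_coeff n l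
       * (aw_basis s k * aw_basis t l))"
proof -
  let ?d = "\<lambda>k l. (q ^ l - q ^ k) / (1 - q ^ (k + l + 1))"
  have "aw_var s * aw_pair_sum n s t = (\<Sum>l\<le>n. aw_coeff n l * aw_basis t l * (aw_var s * (\<Sum>k\<le>n. aw_coeff n k * ?d k l * aw_basis s k)))"
    unfolding aw_pair_sum_def by (subst sum.swap) (simp only: sum_distrib_left mult_ac)
  also have "\<dots> = (\<Sum>l\<le>Suc n. aw_coeff n l * aw_basis t l * (aw_var s * (\<Sum>k\<le>n. aw_coeff n k * ?d k l * aw_basis s k)))"
    by (simp add: aw_coeff_eq_0)
  also have "\<dots> = (\<Sum>l\<le>Suc n. aw_coeff n l * aw_basis t l * (\<Sum>k\<le>Suc n.
      (r / q ^ k * shifted (\<lambda>k. aw_coeff n k * ?d k l) k - (1 - q * (q ^ k)\<^sup>2) / (r * q ^ k) * (aw_coeff n k * ?d k l)) * aw_basis s k))"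
    by (subst aw_var_mult_sum[OF assms]) (simp_all add: aw_coeff_eq_0)
  finally show ?thesis
    by (subst sum.swap) (simp only: sum_distrib_left mult_ac)
qed

text \<open>
  Compare the coefficients of \<open>aw_basis s k * aw_basis t l\<close>.  Multiplication by a variable connects
  only neighbouring indices, so that the kernel occurs with the two denominators
  \<open>1 - q\<^sup>k\<^sup>+\<^sup>l\<^sup>+\<^sup>1\<close> and \<open>1 - q\<^sup>k\<^sup>+\<^sup>l\<close>; both cancel.
\<close>

theorem aw_pair_sum_formula:
  assumes s: "s \<noteq> 0" and t: "t \<noteq> 0"
  shows "(aw_var s + aw_var t) * ((1 - q ^ Suc n) * aw_pair_sum n s t) = aw_sum_lower n t * (aw_var s * aw_sum n s) - aw_sum_lower n s * (aw_var t * aw_sum n t)"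
proof -
  define M where "M = q ^ Suc n"
  have M: "M \<noteq> 0" "1 - M \<noteq> 0" using q_nonzero one_minus_q_power[of n] by (simp_all add: M_def)
  let ?d = "\<lambda>k l. (q ^ l - q ^ k) / (1 - q ^ (k + l + 1))"
  let ?T = "\<lambda>k l. r / q ^ k * shifted (\<lambda>k. aw_coeff n k * ?d k l) k
       - (1 - q * (q ^ k)\<^sup>2) / (r * q ^ k) * (aw_coeff n k * ?d k l)"
  have s2: "aw_var s * aw_pair_sum n s t = (\<Sum>k\<le>Suc n. \<Sum>l\<le>Suc n. ?T k l * aw_coeff n l * (aw_basis s k * aw_basis t l))"
    by (rule aw_var_mult_pair_sum[OF s])
  have "aw_var t * aw_pair_sum n s t = - (\<Sum>k\<le>Suc n. \<Sum>l\<le>Suc n. ?T k l * aw_coeff n l * (aw_basis t k * aw_basis s l))"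
    by (subst aw_pair_sum_swap) (simp only: mult_minus_right aw_var_mult_pair_sum[OF t])
  also have "\<dots> = - (\<Sum>k\<le>Suc n. \<Sum>l\<le>Suc n. ?T l k * aw_coeff n k * (aw_basis s k * aw_basis t l))"
    by (subst sum.swap) (simp only: mult_ac)
  finally have "(aw_var s + aw_var t) * aw_pair_sum n s t = (\<Sum>k\<le>Suc n. \<Sum>l\<le>Suc n. (?T k l * aw_coeff n l - ?T l k * aw_coeff n k) * (aw_basis s k * aw_basis t l))"
    unfolding distrib_right[of "aw_var s"] s2 left_diff_distrib sum_subtractf by (simp only: add_uminus_conv_diff)
  then have "(aw_var s + aw_var t) * ((1 - M) * aw_pair_sum n s t) =
     (\<Sum>k\<le>Suc n. \<Sum>l\<le>Suc n. (1 - M) * (?T k l * aw_coeff n l - ?T l k * aw_coeff n k) * (aw_basis s k * aw_basis t l))"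
    by (simp only: mult.left_commute[of "aw_var s + aw_var t"] sum_distrib_left mult.assoc)
  also have "\<dots> = (\<Sum>k\<le>Suc n. \<Sum>l\<le>Suc n.
      r * M * (1 - M) * ((1 - q ^ k / M) * (1 - q * q ^ k / M) * ((1 - q * (q ^ l)\<^sup>2) * (1 - M)\<^sup>2 / M)
          - (1 - q ^ l / M) * (1 - q * q ^ l / M) * ((1 - q * (q ^ k)\<^sup>2) * (1 - M)\<^sup>2 / M))
        * (aw_core n k * aw_core n l) * (aw_basis s k * aw_basis t l))"
  proof (intro sum.cong refl)
    fix k l
    define K L where "K = q ^ k" and "L = q ^ l"
    have nz: "K \<noteq> 0" "L \<noteq> 0" "1 - q * (K * L) \<noteq> 0"
      using q_nonzero one_minus_q_power[of "k + l"] by (simp_all add: K_def L_def power_add)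
    have d: "?d k l = (L - K) / (1 - q * (K * L))" "?d l k = (K - L) / (1 - q * (K * L))"
      by (simp_all add: K_def L_def power_add mult_ac)
    show "(1 - M) * (?T k l * aw_coeff n l - ?T l k * aw_coeff n k) * (aw_basis s k * aw_basis t l) =
      r * M * (1 - M) * ((1 - q ^ k / M) * (1 - q * q ^ k / M) * ((1 - q * (q ^ l)\<^sup>2) * (1 - M)\<^sup>2 / M)
          - (1 - q ^ l / M) * (1 - q * q ^ l / M) * ((1 - q * (q ^ k)\<^sup>2) * (1 - M)\<^sup>2 / M))
        * (aw_core n k * aw_core n l) * (aw_basis s k * aw_basis t l)"
    \<comment> \<open>At \<open>k = l = 0\<close> the denominator \<open>1 - q\<^sup>k\<^sup>+\<^sup>l\<close> vanishes, but there both sides are 0.\<close>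
    proof (cases "k = 0 \<and> l = 0")
      case True
      then show ?thesis by simp
    next
      case False
      then have W: "1 - K * L \<noteq> 0"
        using q_not_root_of_unity[of "k + l"] by (auto simp: K_def L_def simp flip: power_add)
      have sh: "shifted (\<lambda>k. aw_coeff n k * ?d k l) k = shifted (aw_coeff n) k * ((q * q ^ l - q ^ k) / (1 - q ^ k * q ^ l)) / q" for k l
      proof (cases k)
        case (Suc j)
        have "w * ((q * x - q * y) / z) / q = w * ((x - y) / z)" for w x y z :: complex
          using q_nonzero by (simp flip: right_diff_distrib)
        note e = this
        show ?thesis unfolding Suc shifted.simps power_Suc e by (simp add: power_add mult_ac)
      qed simp
      define A where "A x = (1 - x / M) * (1 - M * x)" for x
      have T: "?T k l = r * aw_core n k / q * ((1 - q * (q ^ k)\<^sup>2) / q ^ k * ((1 - q ^ k)\<^sup>2 * ((q * q ^ l - q ^ k) / (1 - q ^ k * q ^ l))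
          - q * A (q ^ k) * ?d k l))" for k l
      proof -
        have "?T k l = r * aw_core n k / q * ((1 - q * (q ^ k)\<^sup>2) / q ^ k * ((1 - q ^ k)\<^sup>2 * ((q * q ^ l - q ^ k) / (1 - q ^ k * q ^ l))))
          - q / r * aw_core n k * ((1 - q * (q ^ k)\<^sup>2) / q ^ k * (A (q ^ k) * ?d k l))"
          unfolding sh shifted_aw_coeff_eq aw_coeff_eq[of n k] M_def[symmetric] A_def
          by (simp only: times_divide_eq_left times_divide_eq_right divide_divide_eq_left mult_ac)
        also have "q / r * aw_core n k = r * aw_core n k / q * q" unfolding r_divide_q using q_nonzero by simp
        finally show ?thesis by (simp only: right_diff_distrib mult_ac times_divide_eq_left times_divide_eq_right)
      qed
      have cA: "aw_coeff n k = q * (A (q ^ k) * aw_core n k)" for k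
        unfolding aw_coeff_eq M_def[symmetric] A_def by (simp only: mult_ac)
      have TA: "?T k l * aw_coeff n l = r * (aw_core n k * aw_core n l) * (A (q ^ l) * ((1 - q * (q ^ k)\<^sup>2) / q ^ k * ((1 - q ^ k)\<^sup>2 * ((q * q ^ l - q ^ k) / (1 - q ^ k * q ^ l))
          - q * A (q ^ k) * ?d k l)))" for k l
      proof -
        have "r * x / q * y * (q * (a * z)) = r * (x * z) * (a * y)" for x y a z :: complex
          using q_nonzero by simp
        then show ?thesis unfolding T cA[of l] .
      qed
      let ?R = "r * (aw_core n k * aw_core n l)"
      have e1: "?T k l * aw_coeff n l = ?R * (A L * ((1 - q * K\<^sup>2) / K * ((1 - K)\<^sup>2 * ((q * L - K) / (1 - K * L))
          - q * A K * ((L - K) / (1 - q * (K * L))))))"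
        using TA[of k l] unfolding d K_def L_def .
      have e2: "?T l k * aw_coeff n k = ?R * (A K * ((1 - q * L\<^sup>2) / L * ((1 - L)\<^sup>2 * ((q * K - L) / (1 - K * L))
          - q * A L * ((K - L) / (1 - q * (K * L))))))"
        using TA[of l k] unfolding d K_def L_def mult.commute[of "q ^ l" "q ^ k"] mult.commute[of "aw_core n l" "aw_core n k"] .
      have "?T k l * aw_coeff n l - ?T l k * aw_coeff n k = ?R * (M * ((1 - K / M) * (1 - q * K / M) * ((1 - q * L\<^sup>2) * (1 - M)\<^sup>2 / M)
          - (1 - L / M) * (1 - q * L / M) * ((1 - q * K\<^sup>2) * (1 - M)\<^sup>2 / M)))"
        unfolding e1 e2 right_diff_distrib[of ?R, symmetric]
          aw_coefficient_identity[OF nz(1,2) M(1) q_nonzero W nz(3), folded A_def] ..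
      then show ?thesis unfolding K_def L_def by (simp only: mult_ac)
    qed
  qed
  also have "\<dots> = aw_sum_lower n t * (aw_var s * aw_sum n s) - aw_sum_lower n s * (aw_var t * aw_sum n t)"
  proof -
    have 1: "aw_sum_lower n s * (aw_var t * aw_sum n t) = - (\<Sum>k\<le>Suc n. \<Sum>l\<le>Suc n.
      r * M * (1 - M) * ((1 - q ^ k / M) * (1 - q * q ^ k / M) * ((1 - q * (q ^ l)\<^sup>2) * (1 - M)\<^sup>2 / M))
        * (aw_core n k * aw_core n l) * (aw_basis s k * aw_basis t l))" if "t \<noteq> 0" for s t
      unfolding aw_sum_lower_def aw_var_mult_aw_sum[OF that] sum_product M_def[symmetric] sum_negf[symmetric]
      by (simp only: mult_minus_left mult_minus_right times_divide_eq_left times_divide_eq_right mult_ac)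
    have 2: "aw_sum_lower n t * (aw_var s * aw_sum n s) = - (\<Sum>k\<le>Suc n. \<Sum>l\<le>Suc n.
      r * M * (1 - M) * ((1 - q ^ l / M) * (1 - q * q ^ l / M) * ((1 - q * (q ^ k)\<^sup>2) * (1 - M)\<^sup>2 / M))
        * (aw_core n k * aw_core n l) * (aw_basis s k * aw_basis t l))"
      unfolding 1[OF s] by (subst sum.swap) (simp only: mult_ac)
    show ?thesis unfolding 1[OF t] 2
      unfolding right_diff_distrib left_diff_distrib sum_subtractf by (simp only: diff_minus_eq_add add.commute add_uminus_conv_diff)
  qed
  finally show ?thesis unfolding M_def .
qed

section \<open>The identity for variables in general position\<close>

definition aw_multisum :: "nat \<Rightarrow> nat \<Rightarrow> (nat \<Rightarrow> complex) \<Rightarrow> complex" where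
  "aw_multisum n m s = r powi (int (m * (m - 1) div 2) - int (m * n)) *
     ((1 - q ^ (n + 1)) / (1 - q)) ^ m * (\<Prod>i=1..m. s i ^ n) *
     (\<Prod>(i, j)\<in>index_pairs m. (s i + s j) / (1 + s i * s j)) *
     (\<Sum>k\<in>index_tuples n m.
        (\<Prod>(i, j)\<in>index_pairs m. (q ^ k j - q ^ k i) / (1 - q ^ (k i + k j + 1))) *
        (\<Prod>i=1..m. aw_coeff n (k i) * aw_basis (s i) (k i)))"

lemma P_eq_tuple_sum:
  "P q n m x = tuple_sum {0..n} (\<lambda>i k. alt_conv qratio qratio n k * x i ^ k)
     (kernel_prod (\<lambda>(i, k) (j, l). (q ^ l - q ^ k) / (q ^ l + q ^ k))) [1..<Suc m]"
proof -
  let ?c = "\<lambda>k. qpochs [- q, q powi (- int n)] q k / qpochs [q, - (q powi (- int n))] q k"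
  have "(qpoch (- q) q n / qpoch q q n) ^ m * (\<Prod>i=1..m. ?c (k i) * x i ^ k i) =
     (\<Prod>i=1..m. alt_conv qratio qratio n (k i) * x i ^ k i)" if "k \<in> index_tuples n m" for k
  proof -
    have "(qpoch (- q) q n / qpoch q q n) ^ m * (\<Prod>i=1..m. ?c (k i) * x i ^ k i) =
       (\<Prod>i=1..m. qpoch (- q) q n / qpoch q q n * (?c (k i) * x i ^ k i))"
      by (simp only: prod.distrib prod_constant card_atLeastAtMost diff_Suc_1)
    also have "\<dots> = (\<Prod>i=1..m. alt_conv qratio qratio n (k i) * x i ^ k i)"
    proof (rule prod.cong[OF refl])
      fix i assume "i \<in> {1..m}"
      then have "k i \<le> n" using that by (auto simp: index_tuples_def PiE_def Pi_def)
      from coefficient_eq[OF this] show "qpoch (- q) q n / qpoch q q n * (?c (k i) * x i ^ k i) = alt_conv qratio qratio n (k i) * x i ^ k i"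
        by (simp only: mult.assoc[symmetric])
    qed
    finally show ?thesis .
  qed
  then show ?thesis
    unfolding P_def tuple_sum_index_tuples power_divide[symmetric] sum_distrib_left case_prod_conv
    by (intro sum.cong refl) (subst mult.left_commute, rule arg_cong2[where f = "(*)"], rule refl, blast)
qed

lemma aw_multisum_eq_tuple_sum:
  "aw_multisum n m s = (\<Prod>(i, j)\<in>index_pairs m. (s i + s j) / (1 + s i * s j)) *
     tuple_sum {0..n} (\<lambda>i k. (s i / r) ^ n * ((1 - q ^ Suc n) / (1 - q)) * (aw_coeff n k * aw_basis (s i) k))
     (kernel_prod (\<lambda>(i, k) (j, l). r * ((q ^ l - q ^ k) / (1 - q ^ (k + l + 1))))) [1..<Suc m]"
proof -
  have "r powi (int (m * (m - 1) div 2) - int (m * n)) = r ^ card (index_pairs m) / r ^ (m * n)"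
    unfolding card_index_pairs using r_nonzero by (simp add: power_int_diff del: of_nat_mult)
  moreover have "(\<Prod>i=1..m. (s i / r) ^ n * ((1 - q ^ Suc n) / (1 - q)) * (aw_coeff n (k i) * aw_basis (s i) (k i))) =
      1 / r ^ (m * n) * ((1 - q ^ (n + 1)) / (1 - q)) ^ m * (\<Prod>i=1..m. s i ^ n) * (\<Prod>i=1..m. aw_coeff n (k i) * aw_basis (s i) (k i))" for k
    by (simp add: prod.distrib power_divide prod_dividef power_mult power_mult_distrib mult.commute[of m])
  moreover have "(\<Prod>(i, j)\<in>index_pairs m. r * ((q ^ k j - q ^ k i) / (1 - q ^ (k i + k j + 1)))) =
     r ^ card (index_pairs m) * (\<Prod>(i, j)\<in>index_pairs m. (q ^ k j - q ^ k i) / (1 - q ^ (k i + k j + 1)))" for k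
    by (simp only: case_prod_unfold prod.distrib prod_constant)
  ultimately show ?thesis
    unfolding aw_multisum_def tuple_sum_index_tuples case_prod_conv
    by (simp only: sum_distrib_left sum_divide_distrib times_divide_eq_left times_divide_eq_right mult_1_left mult_ac)
qed

text \<open>
  The two transfers through the sum over signs.  The kernel \<open>K1\<close> on signs carries the sum to \<open>P\<^sub>n\<close>,
  the kernel \<open>K2\<close> to the basic hypergeometric sum, and \<open>K1\<close> is \<open>g i j\<close> times \<open>K2\<close>
  independently of the signs.
\<close>

lemma P_eq_aw_multisum_generic:
  assumes nz: "\<And>i. i \<in> {1..m} \<Longrightarrow> s i \<noteq> 0"
    and add: "\<And>i j. i \<in> {1..m} \<Longrightarrow> j \<in> {1..m} \<Longrightarrow> s i + s j \<noteq> 0"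
    and mult: "\<And>i j. i \<in> {1..m} \<Longrightarrow> j \<in> {1..m} \<Longrightarrow> s i * s j \<noteq> 1"
      "\<And>i j. i \<in> {1..m} \<Longrightarrow> j \<in> {1..m} \<Longrightarrow> s i * s j \<noteq> -1"
  shows "P q n m (\<lambda>i. (s i)\<^sup>2) = aw_multisum n m s"
proof -
  let ?X = "{1..m}" and ?I = "{1, -1 :: complex}" and ?is = "[1..<Suc m]"
  define \<Gamma> where "\<Gamma> i = rogers n ((s i)\<^sup>2)" for i
  define \<Lambda> where "\<Lambda> i = - rogers_lower n ((s i)\<^sup>2) / s i" for i
  define v where "v i = aw_var (s i)" for i
  define p where "p i e = (\<Gamma> i + e * \<Lambda> i) / 2" for i e
  define g where "g i j = (s i + s j) / (1 + s i * s j)" for i j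
  define K1 where "K1 = (\<lambda>(i, e) (j, f). (e * s i - f * s j) / (1 - e * s i * (f * s j)))"
  define K2 where "K2 = (\<lambda>(i, e) (j, f). (e * v j - f * v i) / (v i + v j))"
  have v_add: "v i + v j = (s i + s j) * (s i * s j - 1) / (s i * s j)" if "i \<in> ?X" "j \<in> ?X" for i j
    using nz that by (simp add: v_def aw_var_def field_simps)
  have v_nz: "v i + v j \<noteq> 0" if "i \<in> ?X" "j \<in> ?X" for i j
    unfolding v_add[OF that] using nz add mult(1) that by simp
  have plus: "1 + s i * s j \<noteq> 0" if "i \<in> ?X" "j \<in> ?X" for i j
    using mult(2)[OF that] by (simp add: add_eq_0_iff)

  have "schur_kernel_on (?X \<times> ?I) (\<lambda>x y. (- (snd y * s (fst y)) - - (snd x * s (fst x))) / (1 - - (snd x * s (fst x)) * - (snd y * s (fst y))))"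
  proof (rule schur_kernel_tanh)
    fix x y assume "x \<in> ?X \<times> ?I" "y \<in> ?X \<times> ?I"
    then obtain i e j f where "x = (i, e)" "y = (j, f)" "i \<in> ?X" "j \<in> ?X" "e \<in> ?I" "f \<in> ?I" by auto
    then show "1 - - (snd x * s (fst x)) * - (snd y * s (fst y)) \<noteq> 0"
      using mult(1)[of i j] plus[of i j] by (auto simp: neg_eq_iff_add_eq_0 add.commute)
  qed
  then have K1: "schur_kernel_on (?X \<times> ?I) K1"
    by (simp add: K1_def case_prod_unfold)
  have K2: "schur_kernel_on (?X \<times> ?I) K2"
    unfolding K2_def by (rule schur_kernel_signed) (rule v_nz)
  have K12: "K1 (i, e) (j, f) = g i j * K2 (i, e) (j, f)" if "i \<in> ?X" "j \<in> ?X" "e \<in> ?I" "f \<in> ?I" for i j e f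
  proof -
    define S T where "S = s i" and "T = s j"
    have ST: "S \<noteq> 0" "T \<noteq> 0" "S + T \<noteq> 0" "S * T - 1 \<noteq> 0" "1 - S * T \<noteq> 0" "1 + S * T \<noteq> 0"
      using nz add mult(1) plus that by (simp_all add: S_def T_def)
    \<comment> \<open>Only these two sign patterns matter: the kernels change sign when both signs do.\<close>
    have ef: "e * f = 1 \<and> f = e \<or> e * f = -1 \<and> f = - e" using that by auto
    have v: "v i + v j = (S + T) * (S * T - 1) / (S * T)" using v_add[OF that(1,2)] by (simp add: S_def T_def)
    have vij: "v i = S - 1 / S" "v j = T - 1 / T" by (simp_all add: v_def aw_var_def S_def T_def)
    have "g i j * K2 (i, e) (j, f) = (S + T) / (1 + S * T) * ((e * v j - f * v i) / (v i + v j))"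
      by (simp add: g_def K2_def S_def T_def)
    also have "\<dots> = (e * v j - f * v i) * (S * T) / ((1 + S * T) * (S * T - 1))"
      unfolding v using ST by simp
    also have "(e * v j - f * v i) * (S * T) = e * S * (T\<^sup>2 - 1) - f * T * (S\<^sup>2 - 1)"
      unfolding vij using ST by (simp add: field_simps power2_eq_square)
    also have "\<dots> / ((1 + S * T) * (S * T - 1)) = (e * S - f * T) / (1 - e * S * (f * T))"
      using ef
    proof
      assume f: "e * f = 1 \<and> f = e"
      then have e1: "1 - e * S * (f * T) = 1 - S * T" by algebra
      have e2: "e * S * (T\<^sup>2 - 1) - f * T * (S\<^sup>2 - 1) = (e * S - f * T) * ((1 + S * T) * (-1))"
        using f by (simp add: algebra_simps power2_eq_square)
      have e3: "x * (d * (-1)) / (d * y) = x / - y" if "d \<noteq> 0" for x d y :: complex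
        using that by simp
      show ?thesis unfolding e1 e2 e3[OF ST(6)] minus_diff_eq ..
    next
      assume f: "e * f = -1 \<and> f = - e"
      then have "1 - e * S * (f * T) = 1 + S * T" by algebra
      moreover have "e * S * (T\<^sup>2 - 1) - f * T * (S\<^sup>2 - 1) = (e * S - f * T) * (S * T - 1)"
        using f by (simp add: algebra_simps power2_eq_square)
      ultimately show ?thesis using ST by simp
    qed
    finally show ?thesis by (simp add: K1_def S_def T_def)
  qed
  have one: "(\<Sum>e\<in>?I. p i e) = \<Gamma> i" for i
    by (simp add: p_def add_divide_distrib diff_divide_distrib)
  have two: "(\<Sum>e\<in>?I. \<Sum>f\<in>?I. p i e * p j f * K2 (i, e) (j, f)) =
      (\<Lambda> i * \<Gamma> j * v j - \<Gamma> i * \<Lambda> j * v i) / (v i + v j)" for i j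
    unfolding p_def K2_def case_prod_conv by (rule signed_pair_sum)
  have two': "(\<Sum>e\<in>?I. \<Sum>f\<in>?I. p i e * p j f * K1 (i, e) (j, f)) =
      g i j * ((\<Lambda> i * \<Gamma> j * v j - \<Gamma> i * \<Lambda> j * v i) / (v i + v j))" if "i \<in> ?X" "j \<in> ?X" for i j
    unfolding two[symmetric] sum_distrib_left
    by (intro sum.cong refl) (simp add: K12[OF that])

  have "P q n m (\<lambda>i. (s i)\<^sup>2) = tuple_sum ?I p (kernel_prod K1) ?is"
    unfolding P_eq_tuple_sum
  proof (rule tuple_sum_transfer)
    show "schur_kernel_on (?X \<times> {0..n}) (\<lambda>(i, k) (j, l). (q ^ l - q ^ k) / (q ^ l + q ^ k))"
      using schur_kernel_ratio[of "?X \<times> {0..n}" "\<lambda>x. q ^ snd x"] q_power_add_nonzero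
      by (simp add: case_prod_unfold)
    show "schur_kernel_on (?X \<times> ?I) K1" by (rule K1)
    show "(\<Sum>k\<in>{0..n}. alt_conv qratio qratio n k * (s i)\<^sup>2 ^ k) = (\<Sum>e\<in>?I. p i e)" for i
      unfolding one \<Gamma>_def rogers_def atLeast0AtMost ..
    show "set ?is \<subseteq> ?X" "distinct ?is" by auto
    fix i j assume ij: "i \<in> ?X" "j \<in> ?X"
    have x: "(s i)\<^sup>2 * (s j)\<^sup>2 - 1 = (1 + s i * s j) * (s i * s j - 1)" by (simp add: algebra_simps power2_eq_square)
    have nz': "1 + s i * s j \<noteq> 0" "s i * s j - 1 \<noteq> 0" "s i \<noteq> 0" "s j \<noteq> 0" "s i + s j \<noteq> 0"
      using plus mult(1) nz add ij by auto
    have sv: "(s i)\<^sup>2 - 1 = s i * v i" "(s j)\<^sup>2 - 1 = s j * v j"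
      using nz' by (simp_all add: v_def aw_var_def right_diff_distrib power2_eq_square)
    have low: "rogers_lower n ((s i)\<^sup>2) = - s i * \<Lambda> i" "rogers_lower n ((s j)\<^sup>2) = - s j * \<Lambda> j"
      using nz' by (simp_all add: \<Lambda>_def)
    have "(1 + s i * s j) * (s i * s j - 1) * rogers_pair_sum n ((s i)\<^sup>2) ((s j)\<^sup>2) =
       s i * s j * (\<Lambda> i * \<Gamma> j * v j - \<Gamma> i * \<Lambda> j * v i)"
      using rogers_pair_sum_formula[of "(s i)\<^sup>2" "(s j)\<^sup>2" n] unfolding x sv low \<Gamma>_def[symmetric]
      by (simp add: algebra_simps)
    then have "rogers_pair_sum n ((s i)\<^sup>2) ((s j)\<^sup>2) =
       s i * s j * (\<Lambda> i * \<Gamma> j * v j - \<Gamma> i * \<Lambda> j * v i) / ((1 + s i * s j) * (s i * s j - 1))"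
      using nz' by (simp add: eq_divide_eq mult.commute)
    also have "\<dots> = g i j * ((\<Lambda> i * \<Gamma> j * v j - \<Gamma> i * \<Lambda> j * v i) / (v i + v j))"
      unfolding g_def v_add[OF ij] using nz' by simp
    finally show "(\<Sum>k\<in>{0..n}. \<Sum>l\<in>{0..n}. alt_conv qratio qratio n k * (s i)\<^sup>2 ^ k * (alt_conv qratio qratio n l * (s j)\<^sup>2 ^ l) *
        (case (i, k) of (i, k) \<Rightarrow> \<lambda>(j, l). (q ^ l - q ^ k) / (q ^ l + q ^ k)) (j, l)) =
      (\<Sum>e\<in>?I. \<Sum>f\<in>?I. p i e * p j f * K1 (i, e) (j, f))"
      unfolding two'[OF ij] rogers_pair_sum_def atLeast0AtMost case_prod_conv .
  qed
  also have "\<dots> = tuple_sum ?I p (\<lambda>ps. (\<Prod>(i, j)\<in>index_pairs m. g i j) * kernel_prod K2 ps) ?is"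
  proof (rule tuple_sum_cong)
    fix ps assume ps: "map fst ps = ?is" "snd ` set ps \<subseteq> ?I"
    have *: "kernel_prod K1 xs = kernel_prod g (map fst xs) * kernel_prod K2 xs"
      if "set xs \<subseteq> ?X \<times> ?I" for xs
      using that
    proof (induction xs)
      case (Cons a xs)
      have "(\<Prod>b\<leftarrow>ys. K1 a b) = (\<Prod>b\<leftarrow>map fst ys. g (fst a) b) * (\<Prod>b\<leftarrow>ys. K2 a b)" if "set ys \<subseteq> set xs" for ys
        using that
      proof (induction ys)
        case (Cons b ys)
        obtain i e j f where ab: "a = (i, e)" "b = (j, f)" by (cases a, cases b)
        then have "K1 a b = g (fst a) (fst b) * K2 a b"
          using Cons.prems \<open>set (a # xs) \<subseteq> _\<close> by (auto intro!: K12)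
        then show ?case using Cons by simp
      qed simp
      from this[of xs] show ?case using Cons by (simp add: mult_ac)
    qed simp
    have "fst ` set ps = set ?is" by (metis ps(1) list.set_map)
    then have "set ps \<subseteq> ?X \<times> ?I" using ps(2) by force
    note *[OF this]
    moreover have "kernel_prod g (map (\<lambda>i. i) ?is) = (\<Prod>(i, j)\<in>index_pairs m. g i j)"
    proof -
      have "{(i, j). i \<in> set ?is \<and> j \<in> set ?is \<and> i < j} = index_pairs m"
        by (auto simp: index_pairs_def)
      then show ?thesis by (subst kernel_prod_sorted) (simp_all only: sorted_wrt_upt)
    qed
    ultimately show "kernel_prod K1 ps = (\<Prod>(i, j)\<in>index_pairs m. g i j) * kernel_prod K2 ps"
      using ps(1) by (simp only: list.map_ident)
  qed
  also have "\<dots> = (\<Prod>(i, j)\<in>index_pairs m. g i j) * tuple_sum ?I p (kernel_prod K2) ?is"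
    by (rule tuple_sum_mult)
  also have "tuple_sum ?I p (kernel_prod K2) ?is =
     tuple_sum {0..n} (\<lambda>i k. (s i / r) ^ n * ((1 - q ^ Suc n) / (1 - q)) * (aw_coeff n k * aw_basis (s i) k))
       (kernel_prod (\<lambda>(i, k) (j, l). r * ((q ^ l - q ^ k) / (1 - q ^ (k + l + 1))))) ?is"
  proof (rule tuple_sum_transfer)
    show "schur_kernel_on (?X \<times> ?I) K2" by (rule K2)
    have rr: "r * q ^ k * (r * q ^ l) = q ^ (k + l + 1)" for k l
    proof -
      \<comment> \<open>The points of the kernel are \<open>q\<^sup>k\<^sup>+\<^sup>1\<^sup>/\<^sup>2 = r q\<^sup>k\<close>.\<close>
      have "r * q ^ k * (r * q ^ l) = r\<^sup>2 * (q ^ k * q ^ l)" by (simp add: power2_eq_square mult_ac)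
      then show ?thesis by (simp add: sqrt_q power_add)
    qed
    have "schur_kernel_on (?X \<times> {0..n}) (\<lambda>x y. (r * q ^ snd y - r * q ^ snd x) / (1 - r * q ^ snd x * (r * q ^ snd y)))"
    proof (rule schur_kernel_tanh)
      fix x y :: "nat \<times> nat"
      show "1 - r * q ^ snd x * (r * q ^ snd y) \<noteq> 0"
        unfolding rr Suc_eq_plus1[symmetric] by (rule one_minus_q_power)
    qed
    then show "schur_kernel_on (?X \<times> {0..n}) (\<lambda>(i, k) (j, l). r * ((q ^ l - q ^ k) / (1 - q ^ (k + l + 1))))"
      unfolding rr right_diff_distrib[symmetric] times_divide_eq_right[symmetric] by (simp only: case_prod_unfold)
    show "set ?is \<subseteq> ?X" "distinct ?is" by auto
    show "(\<Sum>e\<in>?I. p i e) = (\<Sum>k\<in>{0..n}. (s i / r) ^ n * ((1 - q ^ Suc n) / (1 - q)) * (aw_coeff n k * aw_basis (s i) k))"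
      if "i \<in> ?X" for i
      unfolding one \<Gamma>_def rogers_eq_aw_sum(1)[OF nz[OF that]] aw_sum_def sum_distrib_left atLeast0AtMost ..
    fix i j assume ij: "i \<in> ?X" "j \<in> ?X"
    define \<rho> where "\<rho> i = (s i / r) ^ n" for i
    define M where "M = 1 - q ^ Suc n"
    define Q where "Q = 1 - q"
    have G: "\<Gamma> i = \<rho> i * (M / Q) * aw_sum n (s i)" "\<Lambda> i = - (r * \<rho> i * aw_sum_lower n (s i) / Q)" if "i \<in> ?X" for i
      unfolding \<Gamma>_def \<Lambda>_def rogers_eq_aw_sum[OF nz[OF that]] using nz[OF that] by (simp_all add: \<rho>_def M_def Q_def)
    have "(v i + v j) * (M * aw_pair_sum n (s i) (s j)) = aw_sum_lower n (s j) * (v i * aw_sum n (s i)) - aw_sum_lower n (s i) * (v j * aw_sum n (s j))"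
      unfolding v_def M_def by (rule aw_pair_sum_formula) (use nz ij in auto)
    moreover have "\<Lambda> i * \<Gamma> j * v j - \<Gamma> i * \<Lambda> j * v i =
       r * \<rho> i * \<rho> j * M / Q\<^sup>2 * (aw_sum_lower n (s j) * (v i * aw_sum n (s i)) - aw_sum_lower n (s i) * (v j * aw_sum n (s j)))"
      unfolding G[OF ij(1)] G[OF ij(2)] by (simp add: divide_inverse algebra_simps power2_eq_square)
    ultimately have "\<Lambda> i * \<Gamma> j * v j - \<Gamma> i * \<Lambda> j * v i = r * \<rho> i * \<rho> j * M / Q\<^sup>2 * ((v i + v j) * (M * aw_pair_sum n (s i) (s j)))"
      by simp
    also have "\<dots> = (v i + v j) * (r * \<rho> i * \<rho> j * (M / Q)\<^sup>2 * aw_pair_sum n (s i) (s j))"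
      by (simp add: power2_eq_square mult_ac)
    finally have "(\<Lambda> i * \<Gamma> j * v j - \<Gamma> i * \<Lambda> j * v i) / (v i + v j) = r * \<rho> i * \<rho> j * (M / Q)\<^sup>2 * aw_pair_sum n (s i) (s j)"
      using v_nz[OF ij] by simp
    also have "\<dots> = (\<Sum>k\<in>{0..n}. \<Sum>l\<in>{0..n}. \<rho> i * (M / Q) * (aw_coeff n k * aw_basis (s i) k) * (\<rho> j * (M / Q) * (aw_coeff n l * aw_basis (s j) l)) *
        (r * ((q ^ l - q ^ k) / (1 - q ^ (k + l + 1)))))"
      unfolding aw_pair_sum_def sum_distrib_left atLeast0AtMost by (simp only: power2_eq_square mult_ac)
    finally show "(\<Sum>e\<in>?I. \<Sum>f\<in>?I. p i e * p j f * K2 (i, e) (j, f)) =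
      (\<Sum>k\<in>{0..n}. \<Sum>l\<in>{0..n}. (s i / r) ^ n * ((1 - q ^ Suc n) / (1 - q)) * (aw_coeff n k * aw_basis (s i) k) *
         ((s j / r) ^ n * ((1 - q ^ Suc n) / (1 - q)) * (aw_coeff n l * aw_basis (s j) l)) *
         (case (i, k) of (i, k) \<Rightarrow> \<lambda>(j, l). r * ((q ^ l - q ^ k) / (1 - q ^ (k + l + 1)))) (j, l))"
      unfolding two \<rho>_def M_def Q_def case_prod_conv .
  qed
  finally show ?thesis unfolding aw_multisum_eq_tuple_sum g_def .
qed

section \<open>Removing the genericity assumption by continuity\<close>

lemma isCont_qpoch [continuous_intros]:
  assumes "isCont f t"
  shows "isCont (\<lambda>t. qpoch (f t) q k) t"
  unfolding qpoch_def using assms by (intro continuous_intros)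

lemma isCont_aw_multisum:
  assumes f: "\<And>i. i \<in> {1..m} \<Longrightarrow> isCont (\<lambda>t. f t i) t"
    and nz: "\<And>i. i \<in> {1..m} \<Longrightarrow> f t i \<noteq> 0"
    and den: "\<And>i j. (i, j) \<in> index_pairs m \<Longrightarrow> 1 + f t i * f t j \<noteq> 0"
  shows "isCont (\<lambda>t. aw_multisum n m (f t)) t"
proof -
  have "isCont (\<lambda>t. f t (fst p)) t \<and> isCont (\<lambda>t. f t (snd p)) t \<and> 1 + f t (fst p) * f t (snd p) \<noteq> 0"
    if "p \<in> index_pairs m" for p
    using that f den[of "fst p" "snd p"] by (auto simp: index_pairs_def)
  then show ?thesis
    unfolding aw_multisum_def aw_basis_def case_prod_unfold using f nz by (intro continuous_intros) auto
qed

lemma isCont_P: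
  assumes "\<And>i. i \<in> {1..m} \<Longrightarrow> isCont (\<lambda>t. f t i) t"
  shows "isCont (\<lambda>t. P q n m (f t)) t"
  unfolding P_def using assms by (intro continuous_intros) auto

lemma eventually_quadratic_nonzero:
  fixes a b c :: complex
  assumes "b \<noteq> 0 \<or> c \<noteq> 0"
  shows "eventually (\<lambda>t. a + b * t + c * t\<^sup>2 \<noteq> 0) (at 0)"
proof -
  have "finite {t. poly [:a, b, c:] t = 0}"
    using assms by (intro poly_roots_finite) auto
  then have "eventually (\<lambda>t. \<forall>z\<in>{t. poly [:a, b, c:] t = 0}. t \<noteq> z) (at 0)"
    by (intro eventually_ball_finite) (auto intro: eventually_neq_at_within)
  then show ?thesis
    by (rule eventually_mono) (auto simp: algebra_simps power2_eq_square)
qed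

text \<open>
  Perturb the square roots.  The multiples \<open>i t\<close> of the perturbation have positive integer factors, so
  that the conditions of general position become nonzero polynomials in \<open>t\<close>, whatever the square roots are.
\<close>

lemma P_eq_aw_multisum:
  assumes nz: "\<And>i. i \<in> {1..m} \<Longrightarrow> s i \<noteq> 0"
    and den: "\<And>i j. (i, j) \<in> index_pairs m \<Longrightarrow> 1 + s i * s j \<noteq> 0"
  shows "P q n m (\<lambda>i. (s i)\<^sup>2) = aw_multisum n m s"
proof -
  define f where "f t i = s i + t * of_nat i" for t :: complex and i
  have f0: "f 0 = s" by (simp add: fun_eq_iff f_def)
  have cont: "isCont (\<lambda>t. f t i) 0" for i
    unfolding f_def by (intro continuous_intros)
  have gen: "eventually (\<lambda>t. f t i + f t j \<noteq> 0 \<and> f t i * f t j \<noteq> 1 \<and> f t i * f t j \<noteq> -1) (at 0)"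
    if "i \<in> {1..m}" "j \<in> {1..m}" for i j
  proof -
    have [simp]: "of_nat i \<noteq> (0::complex)" "of_nat j \<noteq> (0::complex)" "of_nat i + of_nat j \<noteq> (0::complex)"
      using that by (auto simp flip: of_nat_add)
    let ?Q = "\<lambda>d t. (s i * s j + d) + (s i * of_nat j + s j * of_nat i) * t + of_nat i * of_nat j * t\<^sup>2"
    have "f t i + f t j = (s i + s j) + (of_nat i + of_nat j) * t + 0 * t\<^sup>2" for t
      by (simp add: f_def algebra_simps)
    moreover have "f t i * f t j + d = ?Q d t" for t d
      by (simp add: f_def algebra_simps power2_eq_square)
    then have "f t i * f t j = 1 \<longleftrightarrow> ?Q (-1) t = 0" "f t i * f t j = -1 \<longleftrightarrow> ?Q 1 t = 0" for t
      by (metis add.right_inverse add_right_cancel, metis add.left_inverse add_right_cancel)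
    ultimately show ?thesis
      by (simp only:) (intro eventually_conj eventually_quadratic_nonzero; use that in simp)
  qed
  have "eventually (\<lambda>t. \<forall>i\<in>{1..m}. \<forall>j\<in>{1..m}. f t i + f t j \<noteq> 0 \<and> f t i * f t j \<noteq> 1 \<and> f t i * f t j \<noteq> -1) (at 0)"
    using gen by (intro eventually_ball_finite ballI) auto
  then have ev: "eventually (\<lambda>t. P q n m (\<lambda>i. (f t i)\<^sup>2) - aw_multisum n m (f t) = 0) (at 0)"
  proof (rule eventually_mono)
    fix t assume *: "\<forall>i\<in>{1..m}. \<forall>j\<in>{1..m}. f t i + f t j \<noteq> 0 \<and> f t i * f t j \<noteq> 1 \<and> f t i * f t j \<noteq> -1"
    have "f t i \<noteq> 0" if "i \<in> {1..m}" for i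
      using bspec[OF bspec[OF * that] that] by auto
    then have "P q n m (\<lambda>i. (f t i)\<^sup>2) = aw_multisum n m (f t)"
      using * by (intro P_eq_aw_multisum_generic) auto
    then show "P q n m (\<lambda>i. (f t i)\<^sup>2) - aw_multisum n m (f t) = 0" by simp
  qed
  have "isCont (\<lambda>t. P q n m (\<lambda>i. (f t i)\<^sup>2) - aw_multisum n m (f t)) 0"
    by (intro continuous_diff isCont_P isCont_aw_multisum continuous_power cont) (use nz den in \<open>auto simp: f0\<close>)
  then have "((\<lambda>t. P q n m (\<lambda>i. (f t i)\<^sup>2) - aw_multisum n m (f t)) \<longlongrightarrow> P q n m (\<lambda>i. (s i)\<^sup>2) - aw_multisum n m s) (at 0)"
    by (simp add: isCont_def f0)
  then have "((\<lambda>t::complex. 0::complex) \<longlongrightarrow> P q n m (\<lambda>i. (s i)\<^sup>2) - aw_multisum n m s) (at 0)"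
    by (rule Lim_transform_eventually[OF _ ev])
  then have "P q n m (\<lambda>i. (s i)\<^sup>2) - aw_multisum n m s = 0"
    by (simp add: tendsto_const_iff)
  then show ?thesis by simp
qed

end

section \<open>The transformation formula\<close>

theorem theorem6p1:
  fixes q r :: complex and n m :: nat and x s :: "nat \<Rightarrow> complex"
  assumes q_nonzero: "q \<noteq> 0"
    and q_not_root_of_unity: "\<And>k::nat. k \<ge> 1 \<Longrightarrow> q ^ k \<noteq> 1"
    and sqrt_q: "r\<^sup>2 = q"
    and m: "m \<ge> 1"
    and x_nonzero: "\<And>i. i \<in> {1..m} \<Longrightarrow> x i \<noteq> 0"
    and sqrt_x: "\<And>i. i \<in> {1..m} \<Longrightarrow> (s i)\<^sup>2 = x i"
    and denominators: "\<And>i j. (i, j) \<in> index_pairs m \<Longrightarrow> 1 + s i * s j \<noteq> 0"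
  shows "P q n m x =
     r powi (int (m * (m - 1) div 2) - int (m * n)) *
     ((1 - q ^ (n + 1)) / (1 - q)) ^ m *
     (\<Prod>i=1..m. s i ^ n) *
     (\<Prod>(i, j)\<in>index_pairs m. (s i + s j) / (1 + s i * s j)) *
     (\<Sum>k\<in>index_tuples n m.
        (\<Prod>(i, j)\<in>index_pairs m. (q ^ k j - q ^ k i) / (1 - q ^ (k i + k j + 1))) *
        (\<Prod>i=1..m. qpochs [q powi (- int n), q ^ (n + 2), r / s i, - (r * s i)] q (k i) /
                     qpochs [q, q, r ^ 3, - (r ^ 3)] q (k i) * q ^ k i))"
proof -
  interpret generic_parameter q r
    by standard (use q_nonzero q_not_root_of_unity sqrt_q in auto)
  have "P q n m x = P q n m (\<lambda>i. (s i)\<^sup>2)"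
    unfolding P_def by (intro arg_cong2[where f = "(*)"] sum.cong prod.cong refl) (simp add: sqrt_x)
  also have "\<dots> = aw_multisum n m s"
  proof (rule P_eq_aw_multisum)
    show "s i \<noteq> 0" if "i \<in> {1..m}" for i
      using x_nonzero[OF that] sqrt_x[OF that] by auto
  qed (rule denominators)
  finally show ?thesis
    unfolding aw_multisum_def aw_coeff_def aw_basis_def by (simp add: qpochs_def mult_ac)
qed

end
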